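(* Let $G$ be a finite nonabelian group. If $U(G)>1$, then there is a prime $p$ such that $G=P\times Q$, where $P$ is a $p$-group and $Q$ is an abelian $p'$-group. Furthermore, $U(G)=U(P)$.
   Context: All groups are finite and characters are complex; $\mathrm{Irr}(G)$ is the set of irreducible characters of $G$, and $Z(G)$ is the center of $G$. For a normal subgroup $N\lhd G$, let $\mathrm{Irr}(G\mid N)=\{\chi\in\mathrm{Irr}(G): N\nleq\ker(\chi)\}$, and let $V(G\mid N)$ be the subgroup of $G$ generated by all $g\in G$ such that $\chi(g)\neq 0$ for some $\chi\in\mathrm{Irr}(G\mid N)$. For $N\lhd G$, let $U(G\mid N)=\prod H$, the product of all normal subgroups $H\lhd G$ satisfying $V(G\mid H)\le N$. Put $U(G)=U(G\mid Z(G))$. A $p'$-group is a group of order not divisible by $p$. *)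

theory Defs
  imports
    "Jordan_Normal_Form.VS_Connect"
    "HOL-Algebra.Algebra"
begin

hide_const (open) Multiset.mult Modules.module Polynomial.order Divisibility.prime

definition mat_trace :: "'a :: comm_monoid_add mat \<Rightarrow> 'a" where
  "mat_trace A = (\<Sum>i<dim_row A. A $$ (i, i))"

definition GL :: "nat \<Rightarrow> complex mat monoid" where
  "GL n = units_of (ring_mat TYPE(complex) n ())"

definition invariant_subspace ::
  "('a, 'b) monoid_scheme \<Rightarrow> nat \<Rightarrow> ('a \<Rightarrow> complex mat) \<Rightarrow> complex vec set \<Rightarrow> bool" where
  "invariant_subspace G n \<rho> W \<longleftrightarrow>
     VectorSpace.subspace class_ring W (module_vec TYPE(complex) n) \<and>
     (\<forall>g\<in>carrier G. \<forall>w\<in>W. \<rho> g *\<^sub>v w \<in> W)"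

definition irreducible_rep ::
  "('a, 'b) monoid_scheme \<Rightarrow> nat \<Rightarrow> ('a \<Rightarrow> complex mat) \<Rightarrow> bool" where
  "irreducible_rep G n \<rho> \<longleftrightarrow>
     \<rho> \<in> hom G (GL n) \<and> n > 0 \<and>
     (\<forall>W. invariant_subspace G n \<rho> W \<longrightarrow> W = {0\<^sub>v n} \<or> W = carrier_vec n)"

text \<open>Characters are restricted to the carrier, so that they are determined by
  their values on \<open>G\<close>.\<close>

definition Irr :: "('a, 'b) monoid_scheme \<Rightarrow> ('a \<Rightarrow> complex) set" where
  "Irr G = {(\<lambda>g\<in>carrier G. mat_trace (\<rho> g)) | n \<rho>. irreducible_rep G n \<rho>}"

definition char_kernel :: "('a, 'b) monoid_scheme \<Rightarrow> ('a \<Rightarrow> complex) \<Rightarrow> 'a set" where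
  "char_kernel G \<chi> = {g \<in> carrier G. \<chi> g = \<chi> \<one>\<^bsub>G\<^esub>}"

definition Irr_over :: "('a, 'b) monoid_scheme \<Rightarrow> 'a set \<Rightarrow> ('a \<Rightarrow> complex) set" where
  "Irr_over G N = {\<chi> \<in> Irr G. \<not> N \<subseteq> char_kernel G \<chi>}"

definition V_over :: "('a, 'b) monoid_scheme \<Rightarrow> 'a set \<Rightarrow> 'a set" where
  "V_over G N = generate G {g \<in> carrier G. \<exists>\<chi>\<in>Irr_over G N. \<chi> g \<noteq> 0}"

text \<open>For a group \<open>G\<close>, the normal subgroups form a commutative monoid under the product
  \<open>HK\<close> of subsets. For finite \<open>G\<close> this gives meaning to the product of an unordered family.\<close>

definition normal_subgroup_monoid :: "('a, 'b) monoid_scheme \<Rightarrow> 'a set monoid" where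
  "normal_subgroup_monoid G =
     \<lparr>carrier = {H. H \<lhd> G}, mult = (<#>\<^bsub>G\<^esub>), one = {\<one>\<^bsub>G\<^esub>}\<rparr>"

lemma (in group) comm_monoid_normal_subgroup_monoid:
  "comm_monoid (normal_subgroup_monoid G)"
proof (rule comm_monoidI)
  fix H K assume H: "H \<in> carrier (normal_subgroup_monoid G)"
    and K: "K \<in> carrier (normal_subgroup_monoid G)"
  then have n: "H \<lhd> G" "K \<lhd> G" by (simp_all add: normal_subgroup_monoid_def)
  then have s: "subgroup H G" "subgroup K G" by (simp_all add: normal_imp_subgroup)
  have sub: "H \<subseteq> carrier G" "K \<subseteq> carrier G" using s by (simp_all add: subgroup.subset)
  have comm: "H <#> K = K <#> H"
    using commut_normal[OF s(1) n(2)] .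
  then show "H \<otimes>\<^bsub>normal_subgroup_monoid G\<^esub> K = K \<otimes>\<^bsub>normal_subgroup_monoid G\<^esub> H"
    by (simp add: normal_subgroup_monoid_def)
  have "subgroup (H <#> K) G"
    using mult_norm_sub_in_sub n s by (metis comm group.mult_norm_subgroup is_group)
  moreover have "x \<otimes> h \<otimes> inv x \<in> H <#> K" if x: "x \<in> carrier G" and h: "h \<in> H <#> K" for x h
  proof -
    obtain a b where ab: "a \<in> H" "b \<in> K" "h = a \<otimes> b" using h by (auto simp: set_mult_def)
    then have c: "a \<in> carrier G" "b \<in> carrier G" using sub by auto
    have "x \<otimes> h \<otimes> inv x = (x \<otimes> a \<otimes> inv x) \<otimes> (x \<otimes> b \<otimes> inv x)"
      using c x ab by (simp add: m_assoc inv_solve_left)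
    moreover have "x \<otimes> a \<otimes> inv x \<in> H" "x \<otimes> b \<otimes> inv x \<in> K"
      using n ab x by (simp_all add: normal.inv_op_closed2)
    ultimately show ?thesis by (auto simp: set_mult_def)
  qed
  ultimately show "H \<otimes>\<^bsub>normal_subgroup_monoid G\<^esub> K \<in> carrier (normal_subgroup_monoid G)"
    by (simp add: normal_subgroup_monoid_def normal_inv_iff)
next
  show "\<one>\<^bsub>normal_subgroup_monoid G\<^esub> \<in> carrier (normal_subgroup_monoid G)"
    by (simp add: normal_subgroup_monoid_def one_is_normal)
next
  fix H K L
  assume "H \<in> carrier (normal_subgroup_monoid G)" "K \<in> carrier (normal_subgroup_monoid G)"
    "L \<in> carrier (normal_subgroup_monoid G)"
  then have "H \<subseteq> carrier G" "K \<subseteq> carrier G" "L \<subseteq> carrier G"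
    by (auto simp: normal_subgroup_monoid_def dest!: normal_imp_subgroup dest: subgroup.subset)
  then show "H \<otimes>\<^bsub>normal_subgroup_monoid G\<^esub> K \<otimes>\<^bsub>normal_subgroup_monoid G\<^esub> L =
      H \<otimes>\<^bsub>normal_subgroup_monoid G\<^esub> (K \<otimes>\<^bsub>normal_subgroup_monoid G\<^esub> L)"
    by (simp add: normal_subgroup_monoid_def set_mult_assoc)
next
  fix H assume "H \<in> carrier (normal_subgroup_monoid G)"
  then have "H \<subseteq> carrier G"
    by (auto simp: normal_subgroup_monoid_def dest!: normal_imp_subgroup dest: subgroup.subset)
  then show "\<one>\<^bsub>normal_subgroup_monoid G\<^esub> \<otimes>\<^bsub>normal_subgroup_monoid G\<^esub> H = H"
    by (force simp: normal_subgroup_monoid_def set_mult_def)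
qed

definition U_over :: "('a, 'b) monoid_scheme \<Rightarrow> 'a set \<Rightarrow> 'a set" where
  "U_over G N =
     finprod (normal_subgroup_monoid G) (\<lambda>H. H) {H. H \<lhd> G \<and> V_over G H \<subseteq> N}"

definition center :: "('a, 'b) monoid_scheme \<Rightarrow> 'a set" where
  "center G = {z \<in> carrier G. \<forall>g\<in>carrier G. z \<otimes>\<^bsub>G\<^esub> g = g \<otimes>\<^bsub>G\<^esub> z}"

definition U :: "('a, 'b) monoid_scheme \<Rightarrow> 'a set" where
  "U G = U_over G (center G)"

definition internal_direct_product ::
  "('a, 'b) monoid_scheme \<Rightarrow> 'a set \<Rightarrow> 'a set \<Rightarrow> bool" where
  "internal_direct_product G P Q \<longleftrightarrow>
     P \<lhd> G \<and> Q \<lhd> G \<and> P \<inter> Q = {\<one>\<^bsub>G\<^esub>} \<and> P <#>\<^bsub>G\<^esub> Q = carrier G"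

end

theory Submission
  imports Defs "Jordan_Normal_Form.Spectral_Radius" "HOL-Library.Function_Algebras"
begin

text \<open>
  The characters enter only through one translation. For \<open>H \<lhd> G\<close>, the condition
  \<open>V(G|H) \<le> Z(G)\<close> says that every \<open>\<chi> \<in> Irr(G|H)\<close> vanishes off \<open>Z(G)\<close>, and this is equivalent to
  a condition on conjugacy classes: for every \<open>g \<notin> Z(G)\<close> the whole coset \<open>gH\<close> lies in the class
  of \<open>g\<close> (\<open>V_over_subset_center_iff_cosets\<close>).

  If the cosets lie in classes and \<open>\<rho>\<close> affords \<open>\<chi>\<close>, then \<open>|H| \<chi>(g)\<close> is the trace of
  \<open>\<rho>(g) \<Sum>\<^sub>h \<rho>(h)\<close>, where \<open>h\<close> runs over \<open>H\<close>; by Schur's lemma the sum over \<open>H\<close> is a scalar, and it is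
  nonzero only if \<open>H\<close> acts trivially. Conversely, suppose that the characters vanish. Multiply
  the sum over the class of \<open>g\<close> by \<open>|H| - \<Sum>\<^sub>h h\<close> in the group algebra. In each irreducible
  representation both factors are scalars, computed by traces; the second one vanishes if \<open>H\<close> is
  in the kernel of the character, and the first one vanishes otherwise. An element of the group
  algebra that acts as zero in every irreducible representation is zero
  (\<open>eq_0_if_killed_by_all_irreducible_reps\<close>), so the class of \<open>g\<close> is a union of cosets of \<open>H\<close>.

  The rest is group theory. The coset condition forces \<open>H \<le> Z(G)\<close>. Let \<open>h \<in> H\<close> and let the prime
  \<open>p\<close> divide the order of \<open>h\<close>. A noncentral element \<open>x\<close> of order prime to \<open>p\<close> would be conjugate to
  \<open>xh\<close>, whose order is divisible by \<open>p\<close>; so all \<open>p'\<close>-elements are central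
  (\<open>regular_elements_central\<close>). Since every element is a product of a \<open>p\<close>-element and a
  \<open>p'\<close>-element, two different primes would make \<open>G\<close> abelian. Hence a nontrivial \<open>U(G)\<close> singles out
  one prime \<open>p\<close>, and \<open>G = P \<times> Q\<close> with \<open>P\<close> a Sylow \<open>p\<close>-subgroup and \<open>Q\<close> the central subgroup of
  \<open>p'\<close>-elements. All admissible \<open>H\<close> are \<open>p\<close>-groups, so they lie in \<open>P\<close>; since \<open>Q\<close> is central,
  the coset condition is the same in \<open>G\<close> and in \<open>P\<close>. Thus \<open>U(G)\<close> and \<open>U(P)\<close> are products of the
  same family of subgroups.
\<close>

hide_const (open) Multiset.mult Modules.module Polynomial.order Divisibility.prime

section \<open>Matrix representations and Schur's lemma\<close>

locale finite_group = group +
  assumes finite_carrier: "finite (carrier G)"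

context group
begin

lemma cancel_inv_left [simp]:
  assumes "x \<in> carrier G" "y \<in> carrier G"
  shows "y \<otimes> (inv y \<otimes> x) = x" "inv y \<otimes> (y \<otimes> x) = x"
  using assms by (simp_all flip: m_assoc)

lemma sum_carrier_left_translate:
  assumes "y \<in> carrier G"
  shows "(\<Sum>x\<in>carrier G. F (y \<otimes> x)) = (\<Sum>x\<in>carrier G. F x)"
  by (rule sum.reindex_bij_witness[of _ "\<lambda>x. inv y \<otimes> x" "\<lambda>x. y \<otimes> x"])
    (use assms in simp_all)

lemma sum_carrier_conjugate:
  assumes "y \<in> carrier G"
  shows "(\<Sum>x\<in>carrier G. F (y \<otimes> x \<otimes> inv y)) = (\<Sum>x\<in>carrier G. F x)"
  by (rule sum.reindex_bij_witness[of _ "\<lambda>x. inv y \<otimes> x \<otimes> y" "\<lambda>x. y \<otimes> x \<otimes> inv y"])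
    (use assms in \<open>simp_all add: m_assoc\<close>)

end

lemma GL_simps:
  "mult (GL n) = (*)" "one (GL n) = 1\<^sub>m n"
  by (auto simp: GL_def units_of_mult units_of_one ring_mat_simps)

lemma carrier_GL:
  "A \<in> carrier (GL n) \<longleftrightarrow>
     A \<in> carrier_mat n n \<and> (\<exists>B\<in>carrier_mat n n. B * A = 1\<^sub>m n \<and> A * B = 1\<^sub>m n)"
  by (auto simp: GL_def units_of_carrier Units_def ring_mat_simps)

lemma subspace_module_vec_iff:
  "VectorSpace.subspace class_ring W (module_vec TYPE(complex) n) \<longleftrightarrow>
     W \<subseteq> carrier_vec n \<and> 0\<^sub>v n \<in> W \<and> (\<forall>v\<in>W. \<forall>w\<in>W. v + w \<in> W) \<and>
     (\<forall>c. \<forall>v\<in>W. c \<cdot>\<^sub>v v \<in> W)"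
  by (auto simp: VectorSpace.subspace_def submodule_def vec_vs vec_module module_vec_simps
      class_ring_simps)

context group
begin

lemma rep_carrier: "\<rho> \<in> hom G (GL n) \<Longrightarrow> x \<in> carrier G \<Longrightarrow> \<rho> x \<in> carrier_mat n n"
  using hom_in_carrier[of \<rho> G "GL n" x] by (simp add: carrier_GL)

lemma rep_mult:
  "\<rho> \<in> hom G (GL n) \<Longrightarrow> x \<in> carrier G \<Longrightarrow> y \<in> carrier G \<Longrightarrow> \<rho> (x \<otimes> y) = \<rho> x * \<rho> y"
  by (simp add: hom_mult GL_simps)

lemma rep_one: assumes "\<rho> \<in> hom G (GL n)" shows "\<rho> \<one> = 1\<^sub>m n"
proof -
  have "monoid (ring_mat TYPE(complex) n ())" 
    using ring_mat[where ?'a=complex and n=n] by (rule ring.is_monoid)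
  then have "group (GL n)" unfolding GL_def by (rule monoid.units_group)
  then show ?thesis using hom_one[OF assms is_group] by (simp add: GL_simps)
qed

end

lemma mat_trace_carrier: "A \<in> carrier_mat n n \<Longrightarrow> mat_trace A = (\<Sum>i<n. A $$ (i, i))"
  by (simp add: mat_trace_def)

lemma mat_mult_entry:
  assumes "A \<in> carrier_mat n n" "B \<in> carrier_mat n n" "i < n" "j < n"
  shows "(A * B) $$ (i, j) = (\<Sum>l<n. A $$ (i, l) * B $$ (l, j))"
  using assms by (auto simp: scalar_prod_def lessThan_atLeast0)

lemma mat_trace_mult_comm:
  assumes "A \<in> carrier_mat n n" "B \<in> carrier_mat n n"
  shows "mat_trace (A * B) = mat_trace (B * A :: 'a :: comm_semiring_0 mat)"
proof -
  have "mat_trace (A * B) = (\<Sum>i<n. \<Sum>j<n. A $$ (i, j) * B $$ (j, i))"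
    using assms by (simp add: mat_trace_def scalar_prod_def lessThan_atLeast0)
  also have "\<dots> = (\<Sum>j<n. \<Sum>i<n. B $$ (j, i) * A $$ (i, j))"
    by (subst sum.swap) (simp add: mult.commute)
  also have "\<dots> = mat_trace (B * A)"
    using assms by (simp add: mat_trace_def scalar_prod_def lessThan_atLeast0)
  finally show ?thesis .
qed

lemma mat_trace_scalar: "mat_trace (c \<cdot>\<^sub>m 1\<^sub>m n) = of_nat n * (c :: complex)"
  by (simp add: mat_trace_def)

text \<open>An eigenspace of \<open>K\<close> is a nonzero invariant subspace, hence everything.\<close>

lemma schur:
  assumes irr: "irreducible_rep G n \<rho>" and K: "K \<in> carrier_mat n n"
    and comm: "\<And>x. x \<in> carrier G \<Longrightarrow> \<rho> x * K = K * \<rho> x"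
    and \<rho>: "\<And>x. x \<in> carrier G \<Longrightarrow> \<rho> x \<in> carrier_mat n n"
  shows "\<exists>c. K = c \<cdot>\<^sub>m 1\<^sub>m n"
proof -
  have "n > 0" using irr by (simp add: irreducible_rep_def)
  then obtain c where "eigenvalue K c"
    using spectrum_non_empty[OF K] by (auto simp: spectrum_def)
  then obtain v where v: "v \<in> carrier_vec n" "v \<noteq> 0\<^sub>v n" "K *\<^sub>v v = c \<cdot>\<^sub>v v"
    using K by (auto simp: eigenvalue_def eigenvector_def)
  define W where "W = {w \<in> carrier_vec n. K *\<^sub>v w = c \<cdot>\<^sub>v w}"
  have "invariant_subspace G n \<rho> W"
    unfolding invariant_subspace_def subspace_module_vec_iff
  proof (intro conjI ballI allI)
    fix x w assume x: "x \<in> carrier G" and w: "w \<in> W"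
    then have "K *\<^sub>v (\<rho> x *\<^sub>v w) = \<rho> x *\<^sub>v (K *\<^sub>v w)"
      using K \<rho>[OF x] comm[OF x] assoc_mult_mat_vec[of K n n "\<rho> x" n w]
        assoc_mult_mat_vec[of "\<rho> x" n n K n w] by (auto simp: W_def)
    also have "\<dots> = c \<cdot>\<^sub>v (\<rho> x *\<^sub>v w)"
      using w \<rho>[OF x] by (simp add: W_def mult_mat_vec)
    finally show "\<rho> x *\<^sub>v w \<in> W"
      using w \<rho>[OF x] by (simp add: W_def)
  qed (use K in \<open>auto simp: W_def mult_add_distrib_mat_vec smult_add_distrib_vec mult_mat_vec
      smult_smult_assoc mult.commute\<close>)
  moreover have "v \<in> W" using v by (simp add: W_def)
  ultimately have "W = carrier_vec n"
    using irr v by (auto simp: irreducible_rep_def)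
  then have eig: "K *\<^sub>v w = c \<cdot>\<^sub>v w" if "w \<in> carrier_vec n" for w
    using that by (auto simp: W_def)
  have "K = c \<cdot>\<^sub>m 1\<^sub>m n"
  proof (rule eq_matI)
    fix i j assume "i < dim_row (c \<cdot>\<^sub>m 1\<^sub>m n)" "j < dim_col (c \<cdot>\<^sub>m 1\<^sub>m n)"
    then have ij: "i < n" "j < n" by auto
    have "K $$ (i, j) = (K *\<^sub>v unit_vec n j) $ i"
      using ij K by auto
    also have "\<dots> = (c \<cdot>\<^sub>m 1\<^sub>m n) $$ (i, j)"
      using ij by (simp add: eig unit_vec_def)
    finally show "K $$ (i, j) = (c \<cdot>\<^sub>m 1\<^sub>m n) $$ (i, j)" .
  qed (use K in auto)
  then show ?thesis ..
qed

section \<open>The group algebra\<close>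

text \<open>Elements of the group algebra are functions on \<open>G\<close> that vanish outside the carrier.
  The value \<open>rep_sum G n \<rho> f\<close> is the image of such an element under the algebra homomorphism
  that extends \<open>\<rho>\<close>.\<close>

definition rep_sum ::
  "('a, 'b) monoid_scheme \<Rightarrow> nat \<Rightarrow> ('a \<Rightarrow> complex mat) \<Rightarrow> ('a \<Rightarrow> complex) \<Rightarrow> complex mat" where
  "rep_sum G n \<rho> f = mat n n (\<lambda>ij. \<Sum>x\<in>carrier G. f x * \<rho> x $$ ij)"

definition convolution ::
  "('a, 'b) monoid_scheme \<Rightarrow> ('a \<Rightarrow> complex) \<Rightarrow> ('a \<Rightarrow> complex) \<Rightarrow> 'a \<Rightarrow> complex" where
  "convolution G f k =
     (\<lambda>x. if x \<in> carrier G then \<Sum>y\<in>carrier G. f y * k (inv\<^bsub>G\<^esub> y \<otimes>\<^bsub>G\<^esub> x) else 0)"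

lemma rep_sum_carrier [simp]: "rep_sum G n \<rho> f \<in> carrier_mat n n"
  by (simp add: rep_sum_def)

context group
begin

lemma rep_mult_rep_sum:
  assumes "\<rho> \<in> hom G (GL n)" "y \<in> carrier G"
  shows "\<rho> y * rep_sum G n \<rho> f = mat n n (\<lambda>ij. \<Sum>x\<in>carrier G. f x * \<rho> (y \<otimes> x) $$ ij)"
proof (rule eq_matI)
  fix i j
  assume "i < dim_row (mat n n (\<lambda>ij. \<Sum>x\<in>carrier G. f x * \<rho> (y \<otimes> x) $$ ij))"
    "j < dim_col (mat n n (\<lambda>ij. \<Sum>x\<in>carrier G. f x * \<rho> (y \<otimes> x) $$ ij))"
  then have ij: "i < n" "j < n" by auto
  note c = rep_carrier[OF assms(1)]
  have "(\<rho> y * rep_sum G n \<rho> f) $$ (i, j) =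
      (\<Sum>l<n. \<rho> y $$ (i, l) * (\<Sum>x\<in>carrier G. f x * \<rho> x $$ (l, j)))"
    using ij c[OF assms(2)] by (simp add: mat_mult_entry[of _ n], simp add: rep_sum_def)
  also have "\<dots> = (\<Sum>x\<in>carrier G. f x * (\<Sum>l<n. \<rho> y $$ (i, l) * \<rho> x $$ (l, j)))"
    by (subst sum_distrib_left, subst sum.swap) (simp add: sum_distrib_left mult_ac)
  also have "\<dots> = (\<Sum>x\<in>carrier G. f x * \<rho> (y \<otimes> x) $$ (i, j))"
    using ij c assms
    by (intro sum.cong refl) (simp add: rep_mult[OF assms(1)] mat_mult_entry[of _ n])
  finally show "(\<rho> y * rep_sum G n \<rho> f) $$ (i, j) =
      mat n n (\<lambda>ij. \<Sum>x\<in>carrier G. f x * \<rho> (y \<otimes> x) $$ ij) $$ (i, j)"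
    using ij by simp
qed (use rep_carrier[OF assms] in \<open>auto simp: rep_sum_def\<close>)

lemma rep_sum_mult_rep:
  assumes "\<rho> \<in> hom G (GL n)" "y \<in> carrier G"
  shows "rep_sum G n \<rho> f * \<rho> y = mat n n (\<lambda>ij. \<Sum>x\<in>carrier G. f x * \<rho> (x \<otimes> y) $$ ij)"
proof (rule eq_matI)
  fix i j
  assume "i < dim_row (mat n n (\<lambda>ij. \<Sum>x\<in>carrier G. f x * \<rho> (x \<otimes> y) $$ ij))"
    "j < dim_col (mat n n (\<lambda>ij. \<Sum>x\<in>carrier G. f x * \<rho> (x \<otimes> y) $$ ij))"
  then have ij: "i < n" "j < n" by auto
  note c = rep_carrier[OF assms(1)]
  have "(rep_sum G n \<rho> f * \<rho> y) $$ (i, j) =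
      (\<Sum>l<n. (\<Sum>x\<in>carrier G. f x * \<rho> x $$ (i, l)) * \<rho> y $$ (l, j))"
    using ij c[OF assms(2)] by (simp add: mat_mult_entry[of _ n], simp add: rep_sum_def)
  also have "\<dots> = (\<Sum>x\<in>carrier G. f x * (\<Sum>l<n. \<rho> x $$ (i, l) * \<rho> y $$ (l, j)))"
    by (subst sum_distrib_right, subst sum.swap) (simp add: sum_distrib_left mult_ac)
  also have "\<dots> = (\<Sum>x\<in>carrier G. f x * \<rho> (x \<otimes> y) $$ (i, j))"
    using ij c assms
    by (intro sum.cong refl) (simp add: rep_mult[OF assms(1)] mat_mult_entry[of _ n])
  finally show "(rep_sum G n \<rho> f * \<rho> y) $$ (i, j) =
      mat n n (\<lambda>ij. \<Sum>x\<in>carrier G. f x * \<rho> (x \<otimes> y) $$ ij) $$ (i, j)"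
    using ij by simp
qed (use rep_carrier[OF assms] in \<open>auto simp: rep_sum_def\<close>)

lemma mat_trace_rep_sum:
  assumes "\<rho> \<in> hom G (GL n)"
  shows "mat_trace (rep_sum G n \<rho> f) = (\<Sum>x\<in>carrier G. f x * mat_trace (\<rho> x))"
proof -
  have "mat_trace (rep_sum G n \<rho> f) = (\<Sum>i<n. \<Sum>x\<in>carrier G. f x * \<rho> x $$ (i, i))"
    by (simp add: rep_sum_def mat_trace_def)
  also have "\<dots> = (\<Sum>x\<in>carrier G. f x * mat_trace (\<rho> x))"
    using rep_carrier[OF assms]
    by (subst sum.swap) (auto intro!: sum.cong simp: mat_trace_carrier[of _ n] sum_distrib_left)
  finally show ?thesis .
qed

lemma rep_sum_convolution:
  assumes "\<rho> \<in> hom G (GL n)"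
  shows "rep_sum G n \<rho> (convolution G f k) = rep_sum G n \<rho> f * rep_sum G n \<rho> k"
proof (rule eq_matI)
  fix i j
  assume "i < dim_row (rep_sum G n \<rho> f * rep_sum G n \<rho> k)"
    "j < dim_col (rep_sum G n \<rho> f * rep_sum G n \<rho> k)"
  then have ij: "i < n" "j < n" by (auto simp: rep_sum_def)
  note c = rep_carrier[OF assms]
  have "rep_sum G n \<rho> (convolution G f k) $$ (i, j) =
      (\<Sum>x\<in>carrier G. \<Sum>y\<in>carrier G. f y * (k (inv y \<otimes> x) * \<rho> x $$ (i, j)))"
    using ij by (simp add: rep_sum_def convolution_def sum_distrib_right mult.assoc)
  also have "\<dots> = (\<Sum>y\<in>carrier G. f y * (\<Sum>x\<in>carrier G. k (inv y \<otimes> x) * \<rho> x $$ (i, j)))"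
    by (subst sum.swap) (simp add: sum_distrib_left)
  also have "\<dots> = (\<Sum>y\<in>carrier G. f y * (\<rho> y * rep_sum G n \<rho> k) $$ (i, j))"
  proof (intro sum.cong refl, goal_cases)
    case (1 y)
    have "(\<Sum>x\<in>carrier G. k (inv y \<otimes> x) * \<rho> x $$ (i, j)) =
        (\<Sum>x\<in>carrier G. k (inv y \<otimes> (y \<otimes> x)) * \<rho> (y \<otimes> x) $$ (i, j))"
      using sum_carrier_left_translate[OF 1, of "\<lambda>x. k (inv y \<otimes> x) * \<rho> x $$ (i, j)"] by simp
    also have "\<dots> = (\<Sum>x\<in>carrier G. k x * \<rho> (y \<otimes> x) $$ (i, j))"
      using 1 by simp
    finally show ?case using ij by (simp add: rep_mult_rep_sum[OF assms 1])
  qed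
  also have "\<dots> = (\<Sum>y\<in>carrier G. f y * (\<Sum>l<n. \<rho> y $$ (i, l) * rep_sum G n \<rho> k $$ (l, j)))"
    using ij c by (intro sum.cong refl) (simp add: mat_mult_entry[of _ n])
  also have "\<dots> = (\<Sum>l<n. (\<Sum>y\<in>carrier G. f y * \<rho> y $$ (i, l)) * rep_sum G n \<rho> k $$ (l, j))"
    unfolding sum_distrib_left sum_distrib_right by (subst sum.swap) (simp add: mult_ac)
  also have "\<dots> = (rep_sum G n \<rho> f * rep_sum G n \<rho> k) $$ (i, j)"
    using ij by (simp add: mat_mult_entry[of _ n], simp add: rep_sum_def)
  finally show "rep_sum G n \<rho> (convolution G f k) $$ (i, j) =
    (rep_sum G n \<rho> f * rep_sum G n \<rho> k) $$ (i, j)" .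
qed (auto simp: rep_sum_def)

text \<open>Class functions are the central elements of the group algebra, so they act as scalars
  in irreducible representations. Taking traces identifies the scalar.\<close>

lemma rep_sum_class_function:
  assumes irr: "irreducible_rep G n \<rho>"
    and cf: "\<And>x y. x \<in> carrier G \<Longrightarrow> y \<in> carrier G \<Longrightarrow> f (y \<otimes> x \<otimes> inv y) = f x"
  obtains c where "rep_sum G n \<rho> f = c \<cdot>\<^sub>m 1\<^sub>m n"
    and "of_nat n * c = (\<Sum>x\<in>carrier G. f x * mat_trace (\<rho> x))"
proof -
  have \<rho>: "\<rho> \<in> hom G (GL n)" using irr by (simp add: irreducible_rep_def)
  have "\<rho> y * rep_sum G n \<rho> f = rep_sum G n \<rho> f * \<rho> y" if y: "y \<in> carrier G" for y
  proof -
    have "(\<Sum>x\<in>carrier G. f x * \<rho> (x \<otimes> y) $$ ij) = (\<Sum>x\<in>carrier G. f x * \<rho> (y \<otimes> x) $$ ij)" for ij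
      using y sum_carrier_conjugate[OF y, of "\<lambda>x. f x * \<rho> (x \<otimes> y) $$ ij"]
        cf[OF _ y] by (simp add: m_assoc)
    then show ?thesis
      by (simp add: rep_mult_rep_sum[OF \<rho> y] rep_sum_mult_rep[OF \<rho> y])
  qed
  then obtain c where c: "rep_sum G n \<rho> f = c \<cdot>\<^sub>m 1\<^sub>m n"
    using schur[OF irr] rep_carrier[OF \<rho>] rep_sum_carrier by metis
  moreover have "of_nat n * c = (\<Sum>x\<in>carrier G. f x * mat_trace (\<rho> x))"
    using mat_trace_rep_sum[OF \<rho>, of f] by (simp add: c mat_trace_scalar)
  ultimately show ?thesis using that by blast
qed

end

section \<open>Semisimplicity of the group algebra\<close>

lemma (in vector_space) representation_sum_basis:
  assumes ind: "\<not> dependent B" and b: "inj_on b I" "b ` I \<subseteq> B" and fin: "finite I" and j: "j \<in> I"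
  shows "representation B (\<Sum>i\<in>I. c i *s b i) (b j) = c j"
proof -
  have sp: "b i \<in> span B" if "i \<in> I" for i using that b span_base by auto
  have "representation B (\<Sum>i\<in>I. c i *s b i) (b j) = (\<Sum>i\<in>I. c i * representation B (b i) (b j))"
    using sp by (simp add: representation_sum[OF ind] representation_scale[OF ind] span_scale)
  also have "\<dots> = (\<Sum>i\<in>I. if i = j then c i else 0)"
    using b j by (intro sum.cong refl) (auto simp: representation_basis[OF ind] inj_on_def image_subset_iff)
  also have "\<dots> = c j" using fin j by simp
  finally show ?thesis .
qed

text \<open>Irreducible characters are traces of matrices, whereas left ideals of the group algebra are
  spaces of functions. Coordinates with respect to a basis turn a minimal invariant subspace into an
  irreducible matrix representation: taking linear combinations of the basis vectors maps
  invariant subspaces of the coordinate space to invariant subspaces of the given space.\<close>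

lemma (in group) irreducible_rep_of_minimal_subspace:
  fixes scale :: "complex \<Rightarrow> 'v :: ab_group_add \<Rightarrow> 'v" and act :: "'a \<Rightarrow> 'v \<Rightarrow> 'v"
  assumes vs: "vector_space scale"
    and ind: "\<not> module.dependent scale B" and fin: "finite B" and ne: "B \<noteq> {}"
    and lin: "\<And>x. x \<in> carrier G \<Longrightarrow> Vector_Spaces.linear scale scale (act x)"
    and closed: "\<And>x v. x \<in> carrier G \<Longrightarrow> v \<in> module.span scale B \<Longrightarrow> act x v \<in> module.span scale B"
    and act_one: "\<And>v. v \<in> module.span scale B \<Longrightarrow> act \<one> v = v"
    and act_mult: "\<And>x y v. x \<in> carrier G \<Longrightarrow> y \<in> carrier G \<Longrightarrow> v \<in> module.span scale B \<Longrightarrow>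
        act (x \<otimes> y) v = act x (act y v)"
    and minimal: "\<And>W. module.subspace scale W \<Longrightarrow> W \<subseteq> module.span scale B \<Longrightarrow>
        (\<And>x v. x \<in> carrier G \<Longrightarrow> v \<in> W \<Longrightarrow> act x v \<in> W) \<Longrightarrow> W = {0} \<or> W = module.span scale B"
  obtains n \<rho> b where "irreducible_rep G n \<rho>" "B = b ` {..<n}"
    "\<And>x j. x \<in> carrier G \<Longrightarrow> j < n \<Longrightarrow> act x (b j) = (\<Sum>i<n. scale (\<rho> x $$ (i, j)) (b i))"
proof -
  interpret vs: vector_space scale by (rule vs)
  define n where "n = card B"
  have "n > 0" using fin ne by (simp add: n_def card_gt_0_iff)
  obtain b where b: "bij_betw b {..<n} B"
    using ex_bij_betw_nat_finite[OF fin] by (auto simp: n_def lessThan_atLeast0)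
  then have B: "B = b ` {..<n}" and inj: "inj_on b {..<n}" by (auto simp: bij_betw_def)
  have bB: "b i \<in> B" if "i < n" for i using that B by auto
  have bsp: "b i \<in> vs.span B" if "i < n" for i using bB[OF that] by (rule vs.span_base)
  define coord where "coord v i = vs.representation B v (b i)" for v i
  have expand: "v = (\<Sum>i<n. scale (coord v i) (b i))" if "v \<in> vs.span B" for v
  proof -
    have "(\<Sum>u\<in>B. scale (vs.representation B v u) u) = v"
      using vs.sum_representation_eq[OF ind that fin] by simp
    then show ?thesis
      using sum.reindex_bij_betw[OF b, of "\<lambda>u. scale (vs.representation B v u) u"]
      by (simp add: coord_def)
  qed
  have coord_sum: "coord (\<Sum>i<n. scale (c i) (b i)) j = c j" if "j < n" for c j
    unfolding coord_def using vs.representation_sum_basis[OF ind inj] bB that by auto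
  have sum_span: "(\<Sum>i<n. scale (c i) (b i)) \<in> vs.span B" for c
    using bsp by (auto intro!: vs.span_sum vs.span_scale)
  have act_sum: "act x (\<Sum>i<n. scale (c i) (b i)) = (\<Sum>i<n. scale (c i) (act x (b i)))"
    if "x \<in> carrier G" for x c
  proof -
    interpret l: Vector_Spaces.linear scale scale "act x" by (rule lin[OF that])
    show ?thesis by (simp add: l.sum l.scale)
  qed
  define \<rho> where "\<rho> x = mat n n (\<lambda>(i, j). coord (act x (b j)) i)" for x
  have \<rho>c: "\<rho> x \<in> carrier_mat n n" for x by (simp add: \<rho>_def)
  have act_b: "act x (b j) = (\<Sum>i<n. scale (\<rho> x $$ (i, j)) (b i))"
    if "x \<in> carrier G" "j < n" for x j
    using expand[OF closed[OF that(1) bsp[OF that(2)]]] that(2) by (simp add: \<rho>_def)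
  have act_lin: "act x (\<Sum>j<n. scale (c j) (b j)) =
      (\<Sum>i<n. scale (\<Sum>j<n. \<rho> x $$ (i, j) * c j) (b i))" if "x \<in> carrier G" for x c
  proof -
    have "act x (\<Sum>j<n. scale (c j) (b j)) =
        (\<Sum>j<n. \<Sum>i<n. scale (\<rho> x $$ (i, j) * c j) (b i))"
      by (simp add: act_sum that act_b vs.scale_sum_right mult.commute)
    also have "\<dots> = (\<Sum>i<n. scale (\<Sum>j<n. \<rho> x $$ (i, j) * c j) (b i))"
      by (subst sum.swap) (simp add: vs.scale_sum_left)
    finally show ?thesis .
  qed
  have \<rho>_mult: "\<rho> (x \<otimes> y) = \<rho> x * \<rho> y" if x: "x \<in> carrier G" and y: "y \<in> carrier G" for x y
  proof (rule eq_matI)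
    fix i j assume "i < dim_row (\<rho> x * \<rho> y)" "j < dim_col (\<rho> x * \<rho> y)"
    then have ij: "i < n" "j < n" by (simp_all add: \<rho>_def)
    have "act (x \<otimes> y) (b j) = act x (\<Sum>i<n. scale (\<rho> y $$ (i, j)) (b i))"
      using act_mult[OF x y bsp] act_b[OF y] ij by simp
    also have "\<dots> = (\<Sum>i<n. scale (\<Sum>k<n. \<rho> x $$ (i, k) * \<rho> y $$ (k, j)) (b i))"
      by (rule act_lin[OF x])
    finally have "coord (act (x \<otimes> y) (b j)) i = (\<Sum>k<n. \<rho> x $$ (i, k) * \<rho> y $$ (k, j))"
      using coord_sum[OF ij(1)] by simp
    then show "\<rho> (x \<otimes> y) $$ (i, j) = (\<rho> x * \<rho> y) $$ (i, j)"
      unfolding mat_mult_entry[OF \<rho>c \<rho>c ij] using ij by (simp add: \<rho>_def[of "x \<otimes> y"])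
  qed (simp_all add: \<rho>_def)
  have \<rho>_one: "\<rho> \<one> = 1\<^sub>m n"
  proof (rule eq_matI)
    fix i j assume "i < dim_row (1\<^sub>m n :: complex mat)" "j < dim_col (1\<^sub>m n :: complex mat)"
    then have ij: "i < n" "j < n" by simp_all
    have "b j = (\<Sum>i<n. scale (if i = j then 1 else 0) (b i))"
    proof -
      have "(\<Sum>i<n. scale (if i = j then 1 else 0) (b i)) = (\<Sum>i<n. if i = j then b i else 0)"
        by (intro sum.cong) auto
      then show ?thesis using ij by simp
    qed
    then have "coord (b j) i = (if i = j then 1 else 0)"
      using coord_sum[OF ij(1), of "\<lambda>i. if i = j then 1 else 0"] by simp
    then show "\<rho> \<one> $$ (i, j) = 1\<^sub>m n $$ (i, j)"
      using ij by (simp add: \<rho>_def act_one bsp)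
  qed (simp_all add: \<rho>_def)
  have hom: "\<rho> \<in> hom G (GL n)"
  proof (rule homI)
    fix x assume x: "x \<in> carrier G"
    have "\<rho> (inv x) * \<rho> x = 1\<^sub>m n" "\<rho> x * \<rho> (inv x) = 1\<^sub>m n"
      using \<rho>_mult[of "inv x" x] \<rho>_mult[of x "inv x"] x by (simp_all add: \<rho>_one)
    then show "\<rho> x \<in> carrier (GL n)"
      using \<rho>c by (auto simp: carrier_GL)
  qed (simp add: \<rho>_mult GL_simps)
  define comb where "comb w = (\<Sum>i<n. scale (w $ i) (b i))" for w
  have comb_act: "comb (\<rho> x *\<^sub>v w) = act x (comb w)"
    if "x \<in> carrier G" "w \<in> carrier_vec n" for x w
  proof -
    have "(\<rho> x *\<^sub>v w) $ i = (\<Sum>j<n. \<rho> x $$ (i, j) * w $ j)" if "i < n" for i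
      using \<open>w \<in> carrier_vec n\<close> that by (simp add: \<rho>_def scalar_prod_def lessThan_atLeast0)
    then show ?thesis using that by (simp add: comb_def act_lin)
  qed
  have comb_inj: "v = w" if "comb v = comb w" "v \<in> carrier_vec n" "w \<in> carrier_vec n" for v w
  proof (rule eq_vecI)
    fix i assume "i < dim_vec w"
    then have "i < n" using that by simp
    then show "v $ i = w $ i"
      using coord_sum[of i "\<lambda>i. v $ i"] coord_sum[of i "\<lambda>i. w $ i"] that(1) by (simp add: comb_def)
  qed (use that in simp)
  have comb_zero: "comb (0\<^sub>v n) = 0" by (simp add: comb_def)
  have "W = {0\<^sub>v n} \<or> W = carrier_vec n" if "invariant_subspace G n \<rho> W" for W
  proof -
    have W: "W \<subseteq> carrier_vec n" "0\<^sub>v n \<in> W" "\<And>v w. v \<in> W \<Longrightarrow> w \<in> W \<Longrightarrow> v + w \<in> W"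
      "\<And>c v. v \<in> W \<Longrightarrow> c \<cdot>\<^sub>v v \<in> W" "\<And>x v. x \<in> carrier G \<Longrightarrow> v \<in> W \<Longrightarrow> \<rho> x *\<^sub>v v \<in> W"
      using that by (auto simp: invariant_subspace_def subspace_module_vec_iff)
    have "vs.subspace (comb ` W)"
    proof (rule vs.subspaceI)
      show "0 \<in> comb ` W" using W(2) comb_zero by force
    next
      fix u v assume "u \<in> comb ` W" "v \<in> comb ` W"
      then obtain u' v' where *: "u' \<in> W" "v' \<in> W" "u = comb u'" "v = comb v'" by auto
      then have "u' \<in> carrier_vec n" "v' \<in> carrier_vec n" using W(1) by auto
      then have "comb (u' + v') = u + v"
        by (simp add: comb_def * vs.scale_left_distrib sum.distrib)
      then show "u + v \<in> comb ` W" using W(3)[OF *(1,2)] by (auto intro: rev_image_eqI)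
    next
      fix c u assume "u \<in> comb ` W"
      then obtain u' where *: "u' \<in> W" "u = comb u'" by auto
      then have "u' \<in> carrier_vec n" using W(1) by auto
      then have "comb (c \<cdot>\<^sub>v u') = scale c u"
        by (simp add: comb_def * vs.scale_sum_right)
      then show "scale c u \<in> comb ` W" using W(4)[OF *(1)] by (metis imageI)
    qed
    moreover have "comb ` W \<subseteq> vs.span B" using sum_span by (auto simp: comb_def)
    moreover have "act x v \<in> comb ` W" if x: "x \<in> carrier G" and v: "v \<in> comb ` W" for x v
    proof -
      obtain w where "w \<in> W" "v = comb w" using v by auto
      then have "act x v = comb (\<rho> x *\<^sub>v w)" using comb_act[OF x, of w] W(1) by auto
      then show ?thesis using W(5)[OF x \<open>w \<in> W\<close>] by simp
    qed
    ultimately consider "comb ` W = {0}" | "comb ` W = vs.span B"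
      using minimal by blast
    then show ?thesis
    proof cases
      case 1
      have "w = 0\<^sub>v n" if "w \<in> W" for w
      proof (rule comb_inj)
        have "comb w \<in> comb ` W" using that by (rule imageI)
        then show "comb w = comb (0\<^sub>v n)" unfolding 1 comb_zero by (rule singletonD)
      qed (use that W(1) in auto)
      then have "W = {0\<^sub>v n}" using W(2) by blast
      then show ?thesis ..
    next
      case 2
      have "w \<in> W" if "w \<in> carrier_vec n" for w
      proof -
        have "comb w \<in> comb ` W" unfolding 2 comb_def by (rule sum_span)
        then obtain w' where w': "w' \<in> W" "comb w = comb w'" by (rule imageE)
        then have "w = w'" using comb_inj[OF w'(2) that] W(1) by blast
        then show ?thesis using w'(1) by simp
      qed
      then have "W = carrier_vec n" using W(1) by blast
      then show ?thesis ..
    qed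
  qed
  then have "irreducible_rep G n \<rho>"
    using hom \<open>n > 0\<close> by (simp add: irreducible_rep_def)
  then show ?thesis using that B act_b by blast
qed

lemma sum_fun_apply:
  "(\<Sum>x\<in>S. F x :: 'a \<Rightarrow> 'b :: comm_monoid_add) z = (\<Sum>x\<in>S. F x z)"
  by (induction S rule: infinite_finite_induct) auto

lemma sum_mult_cnj_eq_0:
  assumes "finite S" "(\<Sum>x\<in>S. f x * cnj (f x)) = 0" "x \<in> S"
  shows "f x = 0"
proof -
  have "complex_of_real (\<Sum>x\<in>S. (cmod (f x))\<^sup>2) = 0"
    using assms(2) by (simp add: complex_norm_square del: of_real_power)
  then have "(\<Sum>x\<in>S. (cmod (f x))\<^sup>2) = 0" by (simp only: of_real_eq_0_iff)
  then show ?thesis using assms(1,3) by (simp add: sum_nonneg_eq_0_iff)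
qed

text \<open>The elements killed by all irreducible representations form a two-sided ideal \<open>J\<close>. If
  \<open>J \<noteq> 0\<close>, it contains a minimal nonzero left ideal \<open>M\<close>, and \<open>M\<close> is itself an irreducible
  representation, so \<open>J\<close> kills \<open>M\<close>. For \<open>m \<in> M\<close> let \<open>k\<close> be the product of \<open>m\<close> and its adjoint; it is
  in \<open>J\<close> and its coefficients are the inner products \<open>k(x) = \<langle>m, xm\<rangle>\<close>. The inner product of
  \<open>km = 0\<close> with \<open>m\<close> is \<open>\<Sum>\<^sub>x |k(x)|\<^sup>2\<close>, so \<open>k = 0\<close>, and \<open>k(1) = \<langle>m, m\<rangle>\<close> gives \<open>m = 0\<close>.\<close>

lemma (in finite_group) eq_0_if_killed_by_all_irreducible_reps:
  fixes f :: "'a \<Rightarrow> complex"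
  assumes supp: "\<And>x. x \<notin> carrier G \<Longrightarrow> f x = 0"
    and killed: "\<And>n \<rho>. irreducible_rep G n \<rho> \<Longrightarrow> rep_sum G n \<rho> f = 0\<^sub>m n n"
  shows "f = 0"
proof (rule ccontr)
  assume "f \<noteq> 0"
  define scale where "scale c g = (\<lambda>x. c * g x)" for c :: complex and g :: "'a \<Rightarrow> complex"
  interpret vs: vector_space scale
    by unfold_locales (auto simp: scale_def algebra_simps)
  define act where "act x g = (\<lambda>z. if z \<in> carrier G then g (inv x \<otimes> z) else 0)"
    for x and g :: "'a \<Rightarrow> complex"
  define J where "J = {g. (\<forall>x. x \<notin> carrier G \<longrightarrow> g x = 0) \<and>
    (\<forall>n \<rho>. irreducible_rep G n \<rho> \<longrightarrow> rep_sum G n \<rho> g = 0\<^sub>m n n)}"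
  have "f \<in> J" using supp killed by (simp add: J_def)
  have sub: "vs.subspace J"
  proof (rule vs.subspaceI)
    show "0 \<in> J" by (auto simp: J_def rep_sum_def)
  next
    fix g k assume "g \<in> J" "k \<in> J"
    moreover have "rep_sum G n \<rho> (g + k) = rep_sum G n \<rho> g + rep_sum G n \<rho> k" for n \<rho>
      by (auto simp: rep_sum_def sum.distrib distrib_right)
    ultimately show "g + k \<in> J" by (auto simp: J_def)
  next
    fix c g assume "g \<in> J"
    moreover have "rep_sum G n \<rho> (scale c g) = c \<cdot>\<^sub>m rep_sum G n \<rho> g" for n \<rho>
      by (auto simp: rep_sum_def sum_distrib_left scale_def mult_ac)
    ultimately show "scale c g \<in> J" by (auto simp: J_def scale_def)
  qed
  have act_J: "act x g \<in> J" if x: "x \<in> carrier G" and g: "g \<in> J" for x g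
  proof -
    have "rep_sum G n \<rho> (act x g) = 0\<^sub>m n n" if irr: "irreducible_rep G n \<rho>" for n \<rho>
    proof -
      have \<rho>: "\<rho> \<in> hom G (GL n)" using irr by (simp add: irreducible_rep_def)
      have "(\<Sum>y\<in>carrier G. act x g y * \<rho> y $$ ij) = (\<Sum>y\<in>carrier G. g y * \<rho> (x \<otimes> y) $$ ij)" for ij
        using sum_carrier_left_translate[OF x, of "\<lambda>y. act x g y * \<rho> y $$ ij"] x
        by (simp add: act_def)
      then have "rep_sum G n \<rho> (act x g) = \<rho> x * rep_sum G n \<rho> g"
        unfolding rep_mult_rep_sum[OF \<rho> x] by (simp add: rep_sum_def)
      then show ?thesis using g irr rep_carrier[OF \<rho> x] by (simp add: J_def)
    qed
    then show ?thesis by (simp add: J_def act_def)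
  qed
  define delta where "delta x = (\<lambda>y. if y = x then 1 else 0 :: complex)" for x :: 'a
  have J_span: "J \<subseteq> vs.span (delta ` carrier G)"
  proof
    fix g assume g: "g \<in> J"
    have "g = (\<Sum>x\<in>carrier G. scale (g x) (delta x))"
    proof
      fix y
      have "(\<Sum>x\<in>carrier G. scale (g x) (delta x)) y = (\<Sum>x\<in>carrier G. if y = x then g x else 0)"
        unfolding sum_fun_apply by (intro sum.cong) (auto simp: scale_def delta_def)
      also have "\<dots> = g y" using g finite_carrier by (simp add: J_def)
      finally show "g y = (\<Sum>x\<in>carrier G. scale (g x) (delta x)) y" by simp
    qed
    also have "\<dots> \<in> vs.span (delta ` carrier G)"
      by (intro vs.span_sum vs.span_scale vs.span_base) auto
    finally show "g \<in> vs.span (delta ` carrier G)" .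
  qed
  define submodule_basis where "submodule_basis B \<longleftrightarrow> \<not> vs.dependent B \<and> B \<noteq> {} \<and>
    vs.span B \<subseteq> J \<and> (\<forall>x\<in>carrier G. \<forall>v\<in>vs.span B. act x v \<in> vs.span B)" for B
  have fin: "finite B" if "submodule_basis B" for B
    using vs.independent_span_bound[of "delta ` carrier G" B] that finite_carrier J_span
      vs.span_superset[of B] by (auto simp: submodule_basis_def)
  obtain B0 where B0: "B0 \<subseteq> J" "\<not> vs.dependent B0" "J \<subseteq> vs.span B0"
    using vs.maximal_independent_subset[of J] by blast
  then have "vs.span B0 = J" using sub vs.span_minimal by blast
  moreover have "B0 \<noteq> {}" using B0(3) \<open>f \<in> J\<close> \<open>f \<noteq> 0\<close> by auto
  ultimately have "submodule_basis B0" using B0 act_J by (simp add: submodule_basis_def)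
  then obtain B where B: "submodule_basis B"
    and least: "\<And>B'. submodule_basis B' \<Longrightarrow> card B \<le> card B'"
    using ex_has_least_nat[of submodule_basis B0 card] by blast
  have ind: "\<not> vs.dependent B" and BJ: "vs.span B \<subseteq> J" and "B \<noteq> {}"
    and closed: "\<And>x v. x \<in> carrier G \<Longrightarrow> v \<in> vs.span B \<Longrightarrow> act x v \<in> vs.span B"
    using B by (auto simp: submodule_basis_def)
  (* A nonzero proper invariant subspace would have a basis with fewer elements than B. *)
  have minimal: "W = {0} \<or> W = vs.span B"
    if W: "vs.subspace W" "W \<subseteq> vs.span B"
      and inv: "\<And>x v. x \<in> carrier G \<Longrightarrow> v \<in> W \<Longrightarrow> act x v \<in> W" for W
  proof (rule ccontr)
    assume *: "\<not> (W = {0} \<or> W = vs.span B)"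
    obtain B' where B': "B' \<subseteq> W" "\<not> vs.dependent B'" "W \<subseteq> vs.span B'"
      using vs.maximal_independent_subset[of W] by blast
    have span: "vs.span B' = W" using B' W(1) vs.span_minimal by blast
    moreover have "B' \<noteq> {}" using * span by auto
    ultimately have sb: "submodule_basis B'"
      using B' W BJ inv by (auto simp: submodule_basis_def)
    obtain v where v: "v \<in> vs.span B" "v \<notin> W" using * W(2) by auto
    have "\<not> vs.dependent (insert v B')"
      using vs.independent_insertI B' v span by blast
    moreover have "insert v B' \<subseteq> vs.span B" using v B' W by auto
    ultimately have "card (insert v B') \<le> card B"
      using vs.independent_span_bound[OF fin[OF B]] by blast
    moreover have "v \<notin> B'" using v B' by auto
    ultimately show False using least[OF sb] fin[OF sb] by simp
  qed
  have lin: "Vector_Spaces.linear scale scale (act x)" if "x \<in> carrier G" for x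
    by unfold_locales (auto simp: act_def scale_def)
  have act_one: "act \<one> v = v" if "v \<in> vs.span B" for v
  proof -
    have "v \<in> J" using that BJ by blast
    then show ?thesis by (auto simp: act_def J_def)
  qed
  have act_mult: "act (x \<otimes> y) v = act x (act y v)" if "x \<in> carrier G" "y \<in> carrier G" "v \<in> vs.span B" for x y v
    using that(1,2) by (auto simp: act_def inv_mult_group m_assoc)
  have "\<exists>n \<rho> b. irreducible_rep G n \<rho> \<and> B = b ` {..<n} \<and>
      (\<forall>x\<in>carrier G. \<forall>j<n. act x (b j) = (\<Sum>i<n. scale (\<rho> x $$ (i, j)) (b i)))"
    by (rule irreducible_rep_of_minimal_subspace[OF vs.vector_space_axioms ind fin[OF B]
            \<open>B \<noteq> {}\<close>, of act])
      (fact lin closed act_one act_mult minimal | blast)+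
  then obtain n \<rho> b where irr: "irreducible_rep G n \<rho>" and b: "B = b ` {..<n}"
    and act_b: "\<And>x j. x \<in> carrier G \<Longrightarrow> j < n \<Longrightarrow> act x (b j) = (\<Sum>i<n. scale (\<rho> x $$ (i, j)) (b i))"
    by blast
  have "n > 0" using irr by (simp add: irreducible_rep_def)
  define m where "m = b 0"
  have mB: "m \<in> B" using \<open>n > 0\<close> b by (auto simp: m_def)
  then have mJ: "m \<in> J" using BJ vs.span_base by blast
  have "m \<noteq> 0" using mB ind vs.dependent_zero by blast
  (* The product of m and its adjoint. *)
  define k where "k = convolution G m (\<lambda>u. cnj (m (inv u)))"
  have k: "k x = (\<Sum>y\<in>carrier G. m y * cnj (m (inv x \<otimes> y)))" if "x \<in> carrier G" for x
    using that by (simp add: k_def convolution_def inv_mult_group)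
  have \<rho>: "\<rho> \<in> hom G (GL n)" using irr by (simp add: irreducible_rep_def)
  have k_killed: "rep_sum G n \<rho> k = 0\<^sub>m n n"
    using mJ irr left_mult_zero_mat[OF rep_sum_carrier]
    by (simp add: J_def k_def rep_sum_convolution[OF \<rho>])
  have "(\<Sum>x\<in>carrier G. scale (k x) (act x m)) =
      (\<Sum>x\<in>carrier G. \<Sum>i<n. scale (k x * \<rho> x $$ (i, 0)) (b i))"
    unfolding m_def by (intro sum.cong refl) (simp only: act_b \<open>n > 0\<close> vs.scale_sum_right vs.scale_scale)
  also have "\<dots> = (\<Sum>i<n. \<Sum>x\<in>carrier G. scale (k x * \<rho> x $$ (i, 0)) (b i))"
    by (rule sum.swap)
  also have "\<dots> = (\<Sum>i<n. scale (rep_sum G n \<rho> k $$ (i, 0)) (b i))"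
    using \<open>n > 0\<close> by (intro sum.cong refl) (simp add: rep_sum_def flip: vs.scale_sum_left)
  also have "\<dots> = 0" using \<open>n > 0\<close> by (simp add: k_killed)
  finally have zero: "(\<Sum>x\<in>carrier G. scale (k x) (act x m)) z = 0" for z by simp
  have km: "(\<Sum>x\<in>carrier G. k x * m (inv x \<otimes> z)) = 0" if "z \<in> carrier G" for z
    using zero[of z] that by (simp add: sum_fun_apply scale_def act_def)
  have "k x * cnj (k x) = (\<Sum>z\<in>carrier G. cnj (m z) * (k x * m (inv x \<otimes> z)))"
    if "x \<in> carrier G" for x
  proof -
    have "cnj (k x) = (\<Sum>z\<in>carrier G. cnj (m z) * m (inv x \<otimes> z))"
      by (simp add: k[OF that])
    then show ?thesis by (simp add: sum_distrib_left mult.left_commute)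
  qed
  then have "(\<Sum>x\<in>carrier G. k x * cnj (k x)) =
      (\<Sum>x\<in>carrier G. \<Sum>z\<in>carrier G. cnj (m z) * (k x * m (inv x \<otimes> z)))"
    by (intro sum.cong refl)
  also have "\<dots> = (\<Sum>z\<in>carrier G. cnj (m z) * (\<Sum>x\<in>carrier G. k x * m (inv x \<otimes> z)))"
    by (subst sum.swap) (simp add: sum_distrib_left)
  also have "\<dots> = 0" by (simp add: km)
  finally have "k \<one> = 0"
    using sum_mult_cnj_eq_0[OF finite_carrier] by blast
  then have "(\<Sum>y\<in>carrier G. m y * cnj (m y)) = 0" by (simp add: k)
  then have on_G: "m y = 0" if "y \<in> carrier G" for y
    using sum_mult_cnj_eq_0[OF finite_carrier] that by blast
  have "m y = 0" for y
    using on_G mJ unfolding J_def by (cases "y \<in> carrier G") blast+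
  then have "m = 0" by (intro ext) simp
  with \<open>m \<noteq> 0\<close> show False by contradiction
qed

section \<open>Vanishing of characters and conjugacy classes\<close>

definition noncentral_cosets_in_classes :: "('a, 'b) monoid_scheme \<Rightarrow> 'a set \<Rightarrow> bool" where
  "noncentral_cosets_in_classes G H \<longleftrightarrow>
     (\<forall>g\<in>carrier G - center G. \<forall>h\<in>H. \<exists>x\<in>carrier G.
        x \<otimes>\<^bsub>G\<^esub> g \<otimes>\<^bsub>G\<^esub> inv\<^bsub>G\<^esub> x = g \<otimes>\<^bsub>G\<^esub> h)"

context group
begin

lemma center_carrier: "center G \<subseteq> carrier G"
  by (auto simp: center_def)

lemma center_commute: "z \<in> center G \<Longrightarrow> g \<in> carrier G \<Longrightarrow> z \<otimes> g = g \<otimes> z"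
  by (simp add: center_def)

lemma center_subgroup: "subgroup (center G) G"
proof (rule subgroupI)
  show "center G \<noteq> {}" by (auto simp: center_def intro!: exI[of _ \<one>])
next
  fix a assume a: "a \<in> center G"
  then have aG: "a \<in> carrier G" by (simp add: center_def)
  have "inv a \<otimes> g = g \<otimes> inv a" if g: "g \<in> carrier G" for g
  proof -
    have "inv (inv g \<otimes> a) = inv (a \<otimes> inv g)" using center_commute[OF a, of "inv g"] g by simp
    then show ?thesis using aG g by (simp add: inv_mult_group)
  qed
  then show "inv a \<in> center G" using a by (simp add: center_def)
next
  fix a b assume ab: "a \<in> center G" "b \<in> center G"
  have c: "a \<in> carrier G" "b \<in> carrier G" using ab by (auto simp: center_def)
  have "a \<otimes> b \<otimes> g = g \<otimes> (a \<otimes> b)" if g: "g \<in> carrier G" for g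
  proof -
    have "a \<otimes> b \<otimes> g = a \<otimes> (g \<otimes> b)" using center_commute[OF ab(2) g] c g by (simp add: m_assoc)
    also have "\<dots> = a \<otimes> g \<otimes> b" using c g by (simp add: m_assoc)
    also have "\<dots> = g \<otimes> (a \<otimes> b)" using center_commute[OF ab(1) g] c g by (simp add: m_assoc)
    finally show ?thesis .
  qed
  then show "a \<otimes> b \<in> center G" using c by (simp add: center_def)
qed (rule center_carrier)

lemma conjugate_in_center:
  assumes "x \<in> carrier G" "g \<in> carrier G" "x \<otimes> g \<otimes> inv x \<in> center G"
  shows "g \<in> center G"
proof -
  have "x \<otimes> (x \<otimes> g \<otimes> inv x) = x \<otimes> g"
    using center_commute[OF assms(3,1)] assms by (simp add: m_assoc)
  then have "x \<otimes> g \<otimes> inv x = g" using assms by simp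
  then show ?thesis using assms(3) by simp
qed

lemma V_over_subset_center_iff:
  "V_over G H \<subseteq> center G \<longleftrightarrow> (\<forall>\<chi>\<in>Irr_over G H. \<forall>g\<in>carrier G - center G. \<chi> g = 0)"
proof -
  have "V_over G H \<subseteq> center G \<longleftrightarrow>
      {g \<in> carrier G. \<exists>\<chi>\<in>Irr_over G H. \<chi> g \<noteq> 0} \<subseteq> center G"
    unfolding V_over_def using generate_subgroup_incl[OF _ center_subgroup]
    by (auto intro: generate.incl)
  then show ?thesis by auto
qed

end

context finite_group
begin

text \<open>The functions \<open>K\<close> and \<open>e\<close> of the proof are the class sum of \<open>g\<close> and the element
  \<open>|H| - \<Sum>\<^sub>h h\<close>. Every irreducible representation kills one of the two, so \<open>Ke = 0\<close>. If \<open>gh\<close> were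
  outside the class of \<open>g\<close>, the coefficient of \<open>Ke\<close> at \<open>gh\<close> would be minus the number of
  conjugates of \<open>g\<close> in the coset \<open>gH\<close>; this number is positive because \<open>g\<close> is one of them.\<close>

lemma noncentral_cosets_in_classes_if_vanishing:
  assumes H: "H \<lhd> G"
    and van: "\<And>\<chi> g. \<chi> \<in> Irr_over G H \<Longrightarrow> g \<in> carrier G - center G \<Longrightarrow> \<chi> g = 0"
  shows "noncentral_cosets_in_classes G H"
  unfolding noncentral_cosets_in_classes_def
proof (intro ballI)
  fix g h assume g: "g \<in> carrier G - center G" and h: "h \<in> H"
  have Hsub: "subgroup H G" using H by (rule normal_imp_subgroup)
  then have HG: "H \<subseteq> carrier G" by (rule subgroup.subset)
  define cl where "cl = {x \<otimes> g \<otimes> inv x | x. x \<in> carrier G}"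
  have cl_sub: "cl \<subseteq> carrier G - center G"
    using g conjugate_in_center by (auto simp: cl_def)
  have cl_conj: "y \<otimes> x \<otimes> inv y \<in> cl" if x: "x \<in> cl" and y: "y \<in> carrier G" for x y
  proof -
    obtain u where u: "u \<in> carrier G" "x = u \<otimes> g \<otimes> inv u" using x by (auto simp: cl_def)
    then have "y \<otimes> x \<otimes> inv y = (y \<otimes> u) \<otimes> g \<otimes> inv (y \<otimes> u)"
      using g y by (simp add: inv_mult_group m_assoc)
    then show ?thesis using u y by (auto simp: cl_def)
  qed
  have conj_iff: "y \<otimes> x \<otimes> inv y \<in> S \<longleftrightarrow> x \<in> S"
    if S: "\<And>x y. x \<in> S \<Longrightarrow> y \<in> carrier G \<Longrightarrow> y \<otimes> x \<otimes> inv y \<in> S"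
      and xy: "x \<in> carrier G" "y \<in> carrier G" for S x y
  proof
    assume "y \<otimes> x \<otimes> inv y \<in> S"
    then have "inv y \<otimes> (y \<otimes> x \<otimes> inv y) \<otimes> inv (inv y) \<in> S" using S xy by blast
    then show "x \<in> S" using xy by (simp add: m_assoc)
  qed (use S xy in blast)
  define K :: "'a \<Rightarrow> complex" where "K x = (if x \<in> cl then 1 else 0)" for x
  define e :: "'a \<Rightarrow> complex" where
    "e x = (if x = \<one> then of_nat (card H) else 0) - (if x \<in> H then 1 else 0)" for x
  have K_class: "K (y \<otimes> x \<otimes> inv y) = K x" if "x \<in> carrier G" "y \<in> carrier G" for x y
    using conj_iff[of cl, OF cl_conj that] by (simp add: K_def)
  have e_class: "e (y \<otimes> x \<otimes> inv y) = e x" if "x \<in> carrier G" "y \<in> carrier G" for x y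
  proof -
    have "y \<otimes> x \<otimes> inv y \<in> H \<longleftrightarrow> x \<in> H"
      using conj_iff[of H, OF _ that] normal.inv_op_closed2[OF H] by blast
    moreover have "y \<otimes> x \<otimes> inv y = \<one> \<longleftrightarrow> x = \<one>"
      using conj_iff[of "{\<one>}", OF _ that] by simp
    ultimately show ?thesis by (simp add: e_def)
  qed
  have T: "convolution G K e = 0"
  proof (rule eq_0_if_killed_by_all_irreducible_reps)
    fix n \<rho> assume irr: "irreducible_rep G n \<rho>"
    then have \<rho>: "\<rho> \<in> hom G (GL n)" and "n > 0" by (simp_all add: irreducible_rep_def)
    obtain c where c: "rep_sum G n \<rho> K = c \<cdot>\<^sub>m 1\<^sub>m n"
      and nc: "of_nat n * c = (\<Sum>x\<in>carrier G. K x * mat_trace (\<rho> x))"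
      using rep_sum_class_function[OF irr K_class] by metis
    obtain d where d: "rep_sum G n \<rho> e = d \<cdot>\<^sub>m 1\<^sub>m n"
      and nd: "of_nat n * d = (\<Sum>x\<in>carrier G. e x * mat_trace (\<rho> x))"
      using rep_sum_class_function[OF irr e_class] by metis
    define \<chi> where "\<chi> = (\<lambda>g\<in>carrier G. mat_trace (\<rho> g))"
    have \<chi>: "\<chi> \<in> Irr G" using irr by (auto simp: Irr_def \<chi>_def)
    have "c = 0 \<or> d = 0"
    proof (cases "\<chi> \<in> Irr_over G H")
      case True
      have "K x * mat_trace (\<rho> x) = 0" if "x \<in> carrier G" for x
        using van[OF True, of x] cl_sub that by (auto simp: K_def \<chi>_def)
      then show ?thesis using nc \<open>n > 0\<close> by simp
    next
      case False
      then have "H \<subseteq> char_kernel G \<chi>" using \<chi> by (simp add: Irr_over_def)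
      then have tr: "mat_trace (\<rho> x) = mat_trace (\<rho> \<one>)" if "x \<in> H" for x
        using that HG by (auto simp: char_kernel_def \<chi>_def)
      have "(\<Sum>x\<in>carrier G. e x * mat_trace (\<rho> x)) =
          (\<Sum>x\<in>carrier G. if x = \<one> then of_nat (card H) * mat_trace (\<rho> x) else 0) -
          (\<Sum>x\<in>carrier G. if x \<in> H then mat_trace (\<rho> x) else 0)"
        unfolding sum_subtractf[symmetric] by (intro sum.cong) (auto simp: e_def left_diff_distrib)
      also have "(\<Sum>x\<in>carrier G. if x \<in> H then mat_trace (\<rho> x) else 0) =
          (\<Sum>x\<in>H. mat_trace (\<rho> x))"
        using HG finite_carrier by (simp add: sum.If_cases Int_absorb1)
      also have "\<dots> = of_nat (card H) * mat_trace (\<rho> \<one>)"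
        using tr by simp
      finally show ?thesis using nd \<open>n > 0\<close> finite_carrier by simp
    qed
    then show "rep_sum G n \<rho> (convolution G K e) = 0\<^sub>m n n"
      by (auto simp: rep_sum_convolution[OF \<rho>] c d)
  qed (simp add: convolution_def)
  have gh: "g \<in> carrier G" "h \<in> carrier G" using g h HG by auto
  show "\<exists>x\<in>carrier G. x \<otimes> g \<otimes> inv x = g \<otimes> h"
  proof (rule ccontr)
    assume "\<not> ?thesis"
    then have "g \<otimes> h \<notin> cl" by (auto simp: cl_def)
    have inv_ne: "inv y \<otimes> (g \<otimes> h) \<noteq> \<one>" if "y \<in> cl" for y
    proof
      assume "inv y \<otimes> (g \<otimes> h) = \<one>"
      then have "g \<otimes> h = y"
        using that cl_sub gh cancel_inv_left(1)[of "g \<otimes> h" y] by auto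
      then show False using that \<open>g \<otimes> h \<notin> cl\<close> by simp
    qed
    define S where "S = {y \<in> carrier G. y \<in> cl \<and> inv y \<otimes> (g \<otimes> h) \<in> H}"
    have "convolution G K e (g \<otimes> h) = (\<Sum>y\<in>carrier G. if y \<in> S then - 1 else 0)"
      using gh inv_ne by (auto intro!: sum.cong simp: convolution_def S_def K_def e_def)
    also have "\<dots> = - of_nat (card S)"
      using finite_carrier by (simp add: sum.If_cases S_def Int_def)
    finally have "card S = 0" using T by simp
    moreover have "finite S" using finite_carrier by (simp add: S_def)
    moreover have "g \<in> cl" using gh by (auto simp: cl_def intro!: exI[of _ \<one>])
    then have "g \<in> S" using gh h by (simp add: S_def)
    ultimately show False by auto
  qed
qed

text \<open>The indicator function \<open>e\<close> of \<open>H\<close> acts as a scalar \<open>c\<close>. Since \<open>\<rho>(h)\<close> fixes this scalar matrix for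
  all \<open>h \<in> H\<close>, a nonzero \<open>c\<close> would put \<open>H\<close> into the kernel. Averaging \<open>\<chi>\<close> over \<open>gH\<close>, where it is
  constant, therefore gives zero.\<close>

lemma vanishing_if_noncentral_cosets_in_classes:
  assumes H: "H \<lhd> G" and cosets: "noncentral_cosets_in_classes G H"
    and \<chi>: "\<chi> \<in> Irr_over G H" and g: "g \<in> carrier G - center G"
  shows "\<chi> g = 0"
proof -
  have Hsub: "subgroup H G" using H by (rule normal_imp_subgroup)
  then have HG: "H \<subseteq> carrier G" by (rule subgroup.subset)
  then have finH: "finite H" using finite_carrier finite_subset by blast
  obtain n \<rho> where irr: "irreducible_rep G n \<rho>" and \<chi>_def: "\<chi> = (\<lambda>g\<in>carrier G. mat_trace (\<rho> g))"
    using \<chi> by (auto simp: Irr_over_def Irr_def)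
  then have \<rho>: "\<rho> \<in> hom G (GL n)" and "n > 0" by (simp_all add: irreducible_rep_def)
  define e :: "'a \<Rightarrow> complex" where "e x = (if x \<in> H then 1 else 0)" for x
  have "e (y \<otimes> x \<otimes> inv y) = e x" if "x \<in> carrier G" "y \<in> carrier G" for x y
  proof -
    have "y \<otimes> x \<otimes> inv y \<in> H \<longleftrightarrow> x \<in> H"
    proof
      assume "y \<otimes> x \<otimes> inv y \<in> H"
      then have "inv y \<otimes> (y \<otimes> x \<otimes> inv y) \<otimes> y \<in> H" using normal.inv_op_closed1[OF H] that by blast
      then show "x \<in> H" using that by (simp add: m_assoc)
    qed (use normal.inv_op_closed2[OF H] that in blast)
    then show ?thesis by (simp add: e_def)
  qed
  then obtain c where c: "rep_sum G n \<rho> e = c \<cdot>\<^sub>m 1\<^sub>m n"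
    using rep_sum_class_function[OF irr, of e] by metis
  have "c = 0"
  proof (rule ccontr)
    assume "c \<noteq> 0"
    have "\<rho> h = 1\<^sub>m n" if h: "h \<in> H" for h
    proof -
      have hG: "h \<in> carrier G" using h HG by auto
      have "inv h \<otimes> x \<in> H \<longleftrightarrow> x \<in> H" if "x \<in> carrier G" for x
      proof
        assume "inv h \<otimes> x \<in> H"
        then have "h \<otimes> (inv h \<otimes> x) \<in> H" using h Hsub by (blast intro: subgroup.m_closed)
        then show "x \<in> H" using that hG by simp
      qed (use h Hsub in \<open>auto intro: subgroup.m_closed subgroup.m_inv_closed\<close>)
      then have e_h: "e (h \<otimes> x) = e x" if "x \<in> carrier G" for x
        using that hG h Hsub by (metis cancel_inv_left(2) e_def m_closed)
      have "(\<Sum>x\<in>carrier G. e x * \<rho> (h \<otimes> x) $$ ij) = (\<Sum>x\<in>carrier G. e x * \<rho> x $$ ij)" for ij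
        using sum_carrier_left_translate[OF hG, of "\<lambda>x. e x * \<rho> x $$ ij"] by (simp add: e_h)
      then have "\<rho> h * rep_sum G n \<rho> e = rep_sum G n \<rho> e"
        unfolding rep_mult_rep_sum[OF \<rho> hG] by (simp add: rep_sum_def)
      then have "c \<cdot>\<^sub>m \<rho> h = c \<cdot>\<^sub>m 1\<^sub>m n"
        using rep_carrier[OF \<rho> hG] by (simp add: c mult_smult_distrib[of _ n n _ n])
      then have "c * \<rho> h $$ (i, j) = c * 1\<^sub>m n $$ (i, j)" if "i < n" "j < n" for i j
        using that rep_carrier[OF \<rho> hG] by (metis carrier_matD index_smult_mat(1) one_carrier_mat)
      then show ?thesis
        using \<open>c \<noteq> 0\<close> rep_carrier[OF \<rho> hG] by (intro eq_matI) auto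
    qed
    then have "H \<subseteq> char_kernel G \<chi>"
      using HG rep_one[OF \<rho>] by (auto simp: char_kernel_def \<chi>_def)
    then show False using \<chi> by (simp add: Irr_over_def)
  qed
  have gG: "g \<in> carrier G" using g by simp
  have tr: "mat_trace (\<rho> (g \<otimes> h)) = mat_trace (\<rho> g)" if h: "h \<in> H" for h
  proof -
    obtain x where x: "x \<in> carrier G" "x \<otimes> g \<otimes> inv x = g \<otimes> h"
      using cosets g \<open>h \<in> H\<close> unfolding noncentral_cosets_in_classes_def by blast
    have "mat_trace (\<rho> (g \<otimes> h)) = mat_trace (\<rho> (x \<otimes> g) * \<rho> (inv x))"
      using x(1) gG by (simp add: rep_mult[OF \<rho>] flip: x(2))
    also have "\<dots> = mat_trace (\<rho> (inv x) * \<rho> (x \<otimes> g))"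
      using x(1) gG by (intro mat_trace_mult_comm[of _ n] rep_carrier[OF \<rho>]) auto
    also have "\<dots> = mat_trace (\<rho> g)"
      using x(1) gG by (simp flip: rep_mult[OF \<rho>])
    finally show ?thesis .
  qed
  have "of_nat (card H) * mat_trace (\<rho> g) = (\<Sum>x\<in>H. mat_trace (\<rho> (g \<otimes> x)))"
    by (simp add: tr)
  also have "\<dots> = (\<Sum>x\<in>carrier G. e x * mat_trace (\<rho> (g \<otimes> x)))"
    using HG finite_carrier
    by (intro sum.mono_neutral_cong_left) (auto simp: e_def)
  also have "\<dots> = mat_trace (\<rho> g * rep_sum G n \<rho> e)"
  proof -
    have "mat_trace (\<rho> g * rep_sum G n \<rho> e) = (\<Sum>i<n. \<Sum>x\<in>carrier G. e x * \<rho> (g \<otimes> x) $$ (i, i))"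
      by (simp add: rep_mult_rep_sum[OF \<rho> gG] mat_trace_def)
    also have "\<dots> = (\<Sum>x\<in>carrier G. e x * mat_trace (\<rho> (g \<otimes> x)))"
      using rep_carrier[OF \<rho>] gG
      by (subst sum.swap) (auto intro!: sum.cong simp: mat_trace_carrier[of _ n] sum_distrib_left)
    finally show ?thesis by simp
  qed
  also have "\<dots> = 0"
    using rep_carrier[OF \<rho> gG] by (simp add: c \<open>c = 0\<close> mat_trace_def)
  finally have "of_nat (card H) * mat_trace (\<rho> g) = 0" .
  moreover have "card H \<noteq> 0" using finH subgroup.one_closed[OF Hsub] by auto
  ultimately show ?thesis using gG by (simp add: \<chi>_def)
qed

lemma V_over_subset_center_iff_cosets:
  assumes "H \<lhd> G"
  shows "V_over G H \<subseteq> center G \<longleftrightarrow> noncentral_cosets_in_classes G H"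
  using noncentral_cosets_in_classes_if_vanishing[OF assms]
    vanishing_if_noncentral_cosets_in_classes[OF assms]
  unfolding V_over_subset_center_iff by blast

end

section \<open>Central p'-elements\<close>

context group
begin

lemma pow_conjugate:
  assumes "x \<in> carrier G" "y \<in> carrier G"
  shows "(y \<otimes> x \<otimes> inv y) [^] (n :: nat) = y \<otimes> x [^] n \<otimes> inv y"
  by (induction n) (use assms in \<open>simp_all add: m_assoc\<close>)

lemma pow_card_subgroup:
  assumes "subgroup S G" "x \<in> S"
  shows "x [^] card S = \<one>"
  using group.pow_order_eq_1[OF subgroup_imp_group[OF assms(1)], of x] assms
  by (simp add: Coset.order_def flip: nat_pow_consistent)

lemma eq_one_if_coprime_pows:
  assumes "x \<in> carrier G" "x [^] (a :: nat) = \<one>" "x [^] (b :: nat) = \<one>" "coprime a b"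
  shows "x = \<one>"
proof -
  have "ord x dvd a" "ord x dvd b" using assms by (simp_all add: pow_eq_id)
  then have "ord x = 1" using coprime_common_divisor[OF assms(4)] by simp
  then show ?thesis using assms(1) ord_eq_1 by blast
qed

text \<open>The factors are powers of \<open>g\<close>, with exponents from a Bezout relation for \<open>a\<close> and \<open>b\<close>.\<close>

lemma coprime_parts:
  assumes g: "g \<in> carrier G" and ord: "order G = a * b" and "coprime a b"
  obtains u v where "u \<in> carrier G" "v \<in> carrier G" "g = u \<otimes> v" "u [^] a = \<one>" "v [^] b = \<one>"
proof -
  obtain s t where st: "s * int a + t * int b = 1"
    using \<open>coprime a b\<close> bezout_int[of "int a" "int b"] by auto
  have triv: "g [^] (int (a * b) * k) = \<one>" for k
  proof -
    have "g [^] (int (a * b) * k) = (g [^] order G) [^] k"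
      using g by (simp add: ord int_pow_pow[symmetric] int_pow_int del: of_nat_mult)
    then show ?thesis using g by (simp add: pow_order_eq_1)
  qed
  show ?thesis
  proof (rule that)
    show "g = g [^] (t * int b) \<otimes> g [^] (s * int a)"
      using g st by (simp add: add.commute flip: int_pow_mult)
    have "(g [^] (t * int b)) [^] a = g [^] (int (a * b) * t)"
      using g by (simp add: int_pow_pow mult_ac flip: int_pow_int)
    then show "(g [^] (t * int b)) [^] a = \<one>" by (simp only: triv)
    have "(g [^] (s * int a)) [^] b = g [^] (int (a * b) * s)"
      using g by (simp add: int_pow_pow mult_ac flip: int_pow_int)
    then show "(g [^] (s * int a)) [^] b = \<one>" by (simp only: triv)
  qed (use g in auto)
qed

lemma subgroup_center_normal:
  assumes "subgroup H G" "H \<subseteq> center G"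
  shows "H \<lhd> G"
proof (rule normal_invI[OF assms(1)])
  fix x h assume x: "x \<in> carrier G" and h: "h \<in> H"
  have "h \<in> carrier G" using h assms(1) subgroup.subset by blast
  have "x \<otimes> h \<otimes> inv x = h \<otimes> x \<otimes> inv x"
    using center_commute[of h x] h x assms(2) by auto
  also have "\<dots> = h" using \<open>h \<in> carrier G\<close> x by (simp add: m_assoc)
  finally have "x \<otimes> h \<otimes> inv x = h" .
  then show "x \<otimes> h \<otimes> inv x \<in> H" using h by simp
qed

text \<open>If \<open>h \<in> H\<close> is not central, neither is its inverse, whose coset contains \<open>\<one>\<close>; but the class
  of a noncentral element does not contain \<open>\<one>\<close>.\<close>

lemma noncentral_cosets_imp_central:
  assumes H: "subgroup H G" and cosets: "noncentral_cosets_in_classes G H"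
  shows "H \<subseteq> center G"
proof
  fix h assume h: "h \<in> H"
  then have hG: "h \<in> carrier G" using H subgroup.subset by blast
  show "h \<in> center G"
  proof (rule ccontr)
    assume "h \<notin> center G"
    then have "inv h \<notin> center G"
      using subgroup.m_inv_closed[OF center_subgroup, of "inv h"] hG by auto
    then obtain x where x: "x \<in> carrier G" "x \<otimes> inv h \<otimes> inv x = inv h \<otimes> h"
      using cosets h hG unfolding noncentral_cosets_in_classes_def by blast
    then have "x \<otimes> inv h \<otimes> inv x \<in> center G"
      using hG subgroup.one_closed[OF center_subgroup] by simp
    then have "inv h \<in> center G" by (rule conjugate_in_center[OF x(1) inv_closed[OF hG]])
    with \<open>inv h \<notin> center G\<close> show False by contradiction
  qed
qed

text \<open>A noncentral \<open>x\<close> is conjugate to \<open>xh\<close>, so \<open>(xh)\<^sup>m = \<one>\<close>. As \<open>h\<close> is central, this gives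
  \<open>h\<^sup>m = \<one>\<close>, which contradicts the choice of \<open>p\<close>.\<close>

lemma regular_elements_central:
  assumes H: "subgroup H G" and cosets: "noncentral_cosets_in_classes G H"
    and h: "h \<in> H" "p dvd ord h" and m: "\<not> p dvd m"
    and x: "x \<in> carrier G" "x [^] (m :: nat) = \<one>"
  shows "x \<in> center G"
proof (rule ccontr)
  assume "x \<notin> center G"
  then obtain y where y: "y \<in> carrier G" "y \<otimes> x \<otimes> inv y = x \<otimes> h"
    using cosets h x unfolding noncentral_cosets_in_classes_def by blast
  have hG: "h \<in> carrier G" using h H subgroup.subset by blast
  have hZ: "h \<in> center G" using noncentral_cosets_imp_central[OF H cosets] h by blast
  have "h [^] m = x [^] m \<otimes> h [^] m" using x hG by simp
  also have "\<dots> = (x \<otimes> h) [^] m"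
    using center_commute[OF hZ x(1)] x(1) hG by (simp add: pow_mult_distrib)
  also have "\<dots> = \<one>" using pow_conjugate[OF x(1) y(1), of m] y x by simp
  finally have "ord h dvd m" using hG by (simp add: pow_eq_id)
  then show False using h(2) m dvd_trans by blast
qed

lemma center_eq_carrier_if_coprime_parts_central:
  assumes "order G = a * b" "coprime a b"
    and "\<And>x. x \<in> carrier G \<Longrightarrow> x [^] a = \<one> \<Longrightarrow> x \<in> center G"
    and "\<And>x. x \<in> carrier G \<Longrightarrow> x [^] b = \<one> \<Longrightarrow> x \<in> center G"
  shows "center G = carrier G"
proof
  show "carrier G \<subseteq> center G"
  proof
    fix g assume "g \<in> carrier G"
    then obtain u v where "u \<in> carrier G" "v \<in> carrier G" "g = u \<otimes> v" "u [^] a = \<one>" "v [^] b = \<one>"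
      using coprime_parts[OF _ assms(1,2)] by blast
    then show "g \<in> center G"
      using assms(3,4) subgroup.m_closed[OF center_subgroup] by blast
  qed
qed (rule center_carrier)

lemma comm_group_if_center_eq_carrier:
  assumes "center G = carrier G"
  shows "comm_group G"
  by (rule group_comm_groupI) (use assms center_commute in auto)

end

section \<open>The direct decomposition and its factor P\<close>

lemma (in group) card_subgroup_dvd:
  assumes "subgroup S G" "subgroup K G" "S \<subseteq> K"
  shows "card S dvd card K"
proof -
  interpret K: group "G\<lparr>carrier := K\<rparr>" using assms(2) by (rule subgroup_imp_group)
  have "card (rcosets\<^bsub>G\<lparr>carrier := K\<rparr>\<^esub> S) * card S = card K"
    using K.lagrange[OF subgroup_incl[OF assms]] by (simp add: Coset.order_def)
  then show ?thesis by (metis dvd_triv_right)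
qed

text \<open>Being central, the \<open>p'\<close>-elements form a subgroup \<open>Q\<close>. It contains a Sylow \<open>q\<close>-subgroup of \<open>G\<close> for
  every prime \<open>q\<close> that divides \<open>m\<close>, so \<open>m\<close> divides \<open>|Q|\<close>. A Sylow \<open>p\<close>-subgroup \<open>P\<close> meets \<open>Q\<close> trivially,
  and counting \<open>PQ\<close> gives both \<open>|Q| = m\<close> and \<open>PQ = G\<close>; \<open>P\<close> is normal because \<open>Q\<close> is central.\<close>

lemma (in finite_group) direct_product_if_regular_elements_central:
  assumes p: "prime p" and ord: "order G = p ^ a * m" and pm: "\<not> p dvd m"
    and central: "\<And>x. x \<in> carrier G \<Longrightarrow> x [^] m = \<one> \<Longrightarrow> x \<in> center G"
  obtains P where "subgroup P G" "card P = p ^ a"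
    "internal_direct_product G P {x \<in> carrier G. x [^] m = \<one>}"
    "card {x \<in> carrier G. x [^] m = \<one>} = m"
proof -
  define Q where "Q = {x \<in> carrier G. x [^] m = \<one>}"
  have QZ: "Q \<subseteq> center G" using central by (auto simp: Q_def)
  have Q: "subgroup Q G"
  proof (rule subgroupI)
    show "Q \<noteq> {}" by (auto simp: Q_def intro!: exI[of _ \<one>])
  next
    fix x y assume xy: "x \<in> Q" "y \<in> Q"
    then have "x \<otimes> y = y \<otimes> x" using QZ center_commute by (auto simp: Q_def)
    then show "x \<otimes> y \<in> Q" using xy by (simp add: Q_def pow_mult_distrib)
  qed (auto simp: Q_def nat_pow_inv)
  have finQ: "finite Q" using finite_carrier by (simp add: Q_def)
  have cardQ: "card Q \<noteq> 0" using finQ subgroup.one_closed[OF Q] by auto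
  have "order G \<noteq> 0" using finite_carrier by (simp add: order_gt_0_iff_finite)
  then have "m \<noteq> 0" using ord by auto
  have cop: "coprime (p ^ a) m" using p pm by (simp add: prime_imp_coprime)
  have "m dvd card Q"
  proof (rule multiplicity_le_imp_dvd[OF \<open>m \<noteq> 0\<close>])
    fix q :: nat assume q: "prime q"
    define b where "b = multiplicity q m"
    have qb: "q ^ b dvd m" by (simp add: b_def multiplicity_dvd)
    then have "q ^ b dvd order G" unfolding ord by (rule dvd_mult)
    then obtain c where "order G = q ^ b * c" by (rule dvdE)
    then obtain S where S: "subgroup S G" "card S = q ^ b"
      using sylow_thm[OF q is_group _ finite_carrier] by blast
    have "S \<subseteq> Q"
    proof
      fix s assume s: "s \<in> S"
      then have "s \<in> carrier G" using S(1) subgroup.subset by blast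
      moreover have "s [^] q ^ b = \<one>" using pow_card_subgroup[OF S(1) s] by (simp add: S(2))
      ultimately show "s \<in> Q" using qb by (auto simp: Q_def pow_eq_id)
    qed
    then have "q ^ b dvd card Q" using card_subgroup_dvd[OF S(1) Q] S(2) by simp
    then show "multiplicity q m \<le> multiplicity q (card Q)"
      using multiplicity_geI[of "card Q" q b] cardQ prime_gt_1_nat[OF q] unfolding b_def by auto
  qed
  then have "m \<le> card Q" using cardQ by (simp add: dvd_imp_le)
  obtain P where P: "subgroup P G" "card P = p ^ a"
    using sylow_thm[OF p is_group ord finite_carrier] by blast
  have PG: "P \<subseteq> carrier G" and QG: "Q \<subseteq> carrier G"
    using P Q by (simp_all add: subgroup.subset)
  have PQ: "P \<inter> Q = {\<one>}"
  proof
    show "P \<inter> Q \<subseteq> {\<one>}"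
    proof
      fix x assume x: "x \<in> P \<inter> Q"
      then have "x [^] (p ^ a) = \<one>" using pow_card_subgroup[OF P(1)] by (simp add: P(2))
      then show "x \<in> {\<one>}"
        using eq_one_if_coprime_pows[OF _ _ _ cop, of x] x by (auto simp: Q_def)
    qed
  qed (use P Q subgroup.one_closed in auto)
  have inj: "inj_on (\<lambda>(x, y). x \<otimes> y) (P \<times> Q)"
  proof (rule inj_onI, clarify)
    fix x y x' y' assume xy: "x \<in> P" "y \<in> Q" "x' \<in> P" "y' \<in> Q" "x \<otimes> y = x' \<otimes> y'"
    then have c: "x \<in> carrier G" "y \<in> carrier G" "x' \<in> carrier G" "y' \<in> carrier G"
      using PG QG by auto
    have eq: "inv x' \<otimes> x = y' \<otimes> inv y"
    proof -
      have "inv x' \<otimes> x = inv x' \<otimes> (x \<otimes> y) \<otimes> inv y" using c by (simp add: m_assoc)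
      also have "\<dots> = y' \<otimes> inv y" using c by (simp add: xy(5) m_assoc)
      finally show ?thesis .
    qed
    have "inv x' \<otimes> x \<in> P"
      using xy by (intro subgroup.m_closed[OF P(1)] subgroup.m_inv_closed[OF P(1)])
    moreover have "y' \<otimes> inv y \<in> Q"
      using xy by (intro subgroup.m_closed[OF Q] subgroup.m_inv_closed[OF Q])
    ultimately have one: "inv x' \<otimes> x = \<one>" using PQ eq by auto
    then have "x = x'" using c cancel_inv_left(1)[of x x'] by simp
    moreover have "y = y'" using xy(5) c \<open>x = x'\<close> by simp
    ultimately show "x = x' \<and> y = y'" by simp
  qed
  have img: "P <#> Q = (\<lambda>(x, y). x \<otimes> y) ` (P \<times> Q)" by (auto simp: set_mult_def)
  have card_PQ: "card (P <#> Q) = p ^ a * card Q"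
    unfolding img card_image[OF inj] by (simp add: card_cartesian_product P(2))
  have sub: "P <#> Q \<subseteq> carrier G" using PG QG by (rule set_mult_closed)
  then have "p ^ a * card Q \<le> p ^ a * m"
    using card_mono[OF finite_carrier] card_PQ ord by (metis Coset.order_def)
  then have cQ: "card Q = m" using \<open>m \<le> card Q\<close> p prime_gt_0_nat[OF p] by simp
  have PQG: "P <#> Q = carrier G"
    using card_subset_eq[OF finite_carrier sub] card_PQ cQ ord by (simp add: Coset.order_def)
  have "P \<lhd> G"
  proof (rule normal_invI[OF P(1)])
    fix x h assume x: "x \<in> carrier G" and h: "h \<in> P"
    then have hG: "h \<in> carrier G" using PG by blast
    obtain u z where uz: "u \<in> P" "z \<in> Q" "x = u \<otimes> z" using x unfolding PQG[symmetric] set_mult_def by blast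
    then have c: "u \<in> carrier G" "z \<in> carrier G" using PG QG by auto
    have "z \<otimes> h = h \<otimes> z" using center_commute uz(2) QZ hG by blast
    then have "z \<otimes> (h \<otimes> k) = h \<otimes> (z \<otimes> k)" if "k \<in> carrier G" for k
      using c hG that by (simp flip: m_assoc)
    then have "x \<otimes> h \<otimes> inv x = u \<otimes> h \<otimes> inv u"
      using c hG by (simp add: uz(3) inv_mult_group m_assoc)
    also have "\<dots> \<in> P" using uz(1) h P(1) by (intro subgroup.m_closed[OF P(1)] subgroup.m_inv_closed[OF P(1)])
    finally show "x \<otimes> h \<otimes> inv x \<in> P" .
  qed
  then have "internal_direct_product G P Q"
    using subgroup_center_normal[OF Q QZ] PQ PQG by (simp add: internal_direct_product_def)
  then show ?thesis using that P cQ by (simp add: Q_def)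
qed

lemma (in group) finprod_normal_subgroup_monoid_restrict:
  assumes P: "subgroup P G" and F: "finite F"
    and "\<And>H. H \<in> F \<Longrightarrow> H \<lhd> G" "\<And>H. H \<in> F \<Longrightarrow> H \<lhd> G\<lparr>carrier := P\<rparr>"
  shows "finprod (normal_subgroup_monoid G) (\<lambda>H. H) F =
    finprod (normal_subgroup_monoid (G\<lparr>carrier := P\<rparr>)) (\<lambda>H. H) F"
proof -
  interpret P: group "G\<lparr>carrier := P\<rparr>" using P by (rule subgroup_imp_group)
  interpret NG: comm_monoid "normal_subgroup_monoid G"
    by (rule comm_monoid_normal_subgroup_monoid)
  interpret NP: comm_monoid "normal_subgroup_monoid (G\<lparr>carrier := P\<rparr>)"
    by (rule P.comm_monoid_normal_subgroup_monoid)
  show ?thesis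
    using F assms(3,4)
  proof (induction F rule: finite_induct)
    case empty
    show ?case
      unfolding NG.finprod_empty NP.finprod_empty by (simp add: normal_subgroup_monoid_def)
  next
    case (insert H F)
    then have "finprod (normal_subgroup_monoid G) (\<lambda>H. H) (insert H F) =
        H \<otimes>\<^bsub>normal_subgroup_monoid G\<^esub> finprod (normal_subgroup_monoid G) (\<lambda>H. H) F"
      by (intro NG.finprod_insert) (auto simp: normal_subgroup_monoid_def)
    moreover have "finprod (normal_subgroup_monoid (G\<lparr>carrier := P\<rparr>)) (\<lambda>H. H) (insert H F) =
        H \<otimes>\<^bsub>normal_subgroup_monoid (G\<lparr>carrier := P\<rparr>)\<^esub>
          finprod (normal_subgroup_monoid (G\<lparr>carrier := P\<rparr>)) (\<lambda>H. H) F"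
      using insert by (intro NP.finprod_insert) (auto simp: normal_subgroup_monoid_def)
    ultimately show ?case
      using insert by (simp add: normal_subgroup_monoid_def set_mult_def)
  qed
qed

context group
begin

lemma center_direct_factor:
  assumes P: "subgroup P G" and QZ: "Q \<subseteq> center G" and PQ: "P <#> Q = carrier G"
  shows "center (G\<lparr>carrier := P\<rparr>) = P \<inter> center G"
proof
  have PG: "P \<subseteq> carrier G" using P by (rule subgroup.subset)
  have QG: "Q \<subseteq> carrier G" using QZ center_carrier by blast
  show "center (G\<lparr>carrier := P\<rparr>) \<subseteq> P \<inter> center G"
  proof
    fix z assume z: "z \<in> center (G\<lparr>carrier := P\<rparr>)"
    then have zP: "z \<in> P" and comm: "\<And>u. u \<in> P \<Longrightarrow> z \<otimes> u = u \<otimes> z" by (auto simp: center_def)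
    have zG: "z \<in> carrier G" using zP PG by blast
    have "z \<otimes> g = g \<otimes> z" if g: "g \<in> carrier G" for g
    proof -
      obtain u y where uy: "u \<in> P" "y \<in> Q" "g = u \<otimes> y" using g unfolding PQ[symmetric] set_mult_def by blast
      then have c: "u \<in> carrier G" "y \<in> carrier G" using PG QG by auto
      have "z \<otimes> g = u \<otimes> (z \<otimes> y)" using comm[OF uy(1)] c zG by (simp add: uy(3) flip: m_assoc)
      also have "z \<otimes> y = y \<otimes> z" using center_commute[of y z] uy(2) QZ zG by auto
      finally show ?thesis using c zG by (simp add: uy(3) m_assoc)
    qed
    then show "z \<in> P \<inter> center G" using zP zG by (simp add: center_def)
  qed
  show "P \<inter> center G \<subseteq> center (G\<lparr>carrier := P\<rparr>)" using PG by (auto simp: center_def)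
qed

text \<open>Write elements of \<open>G\<close> as \<open>uy\<close> with \<open>u \<in> P\<close> and \<open>y \<in> Q\<close>. The central factor \<open>y\<close> does not affect
  conjugation by \<open>uy\<close>, and it can be moved out of a conjugate of \<open>uy\<close>; moreover \<open>uy\<close> is central
  if and only if \<open>u\<close> is.\<close>

lemma noncentral_cosets_direct_factor_iff:
  assumes P: "subgroup P G" and QZ: "Q \<subseteq> center G" and PQ: "P <#> Q = carrier G"
    and HP: "H \<subseteq> P"
  shows "noncentral_cosets_in_classes (G\<lparr>carrier := P\<rparr>) H \<longleftrightarrow> noncentral_cosets_in_classes G H"
proof
  have PG: "P \<subseteq> carrier G" using P by (rule subgroup.subset)
  have QG: "Q \<subseteq> carrier G" using QZ center_carrier by blast
  note center = center_direct_factor[OF P QZ PQ]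
  {
    assume cosets: "noncentral_cosets_in_classes (G\<lparr>carrier := P\<rparr>) H"
    show "noncentral_cosets_in_classes G H"
      unfolding noncentral_cosets_in_classes_def
    proof (intro ballI)
      fix g h assume g: "g \<in> carrier G - center G" and h: "h \<in> H"
      obtain u y where uy: "u \<in> P" "y \<in> Q" "g = u \<otimes> y"
        using g unfolding PQ[symmetric] set_mult_def by blast
      then have c: "u \<in> carrier G" "y \<in> carrier G" "h \<in> carrier G" using PG QG HP h by auto
      have yZ: "y \<in> center G" using uy(2) QZ by blast
      then have "u \<notin> center G" using g uy(3) subgroup.m_closed[OF center_subgroup] by blast
      then obtain x where x: "x \<in> P" "x \<otimes> u \<otimes> inv x = u \<otimes> h"
        using cosets uy(1) h P unfolding noncentral_cosets_in_classes_def center by force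
      have xG: "x \<in> carrier G" using x(1) PG by blast
      have "x \<otimes> g \<otimes> inv x = x \<otimes> u \<otimes> (y \<otimes> inv x)" using c xG by (simp add: uy(3) m_assoc)
      also have "y \<otimes> inv x = inv x \<otimes> y" using center_commute[OF yZ] xG by simp
      also have "x \<otimes> u \<otimes> (inv x \<otimes> y) = u \<otimes> h \<otimes> y" using c xG x(2) by (simp flip: m_assoc)
      also have "\<dots> = g \<otimes> h" using center_commute[OF yZ c(3)] c by (simp add: uy(3) m_assoc)
      finally show "\<exists>x\<in>carrier G. x \<otimes> g \<otimes> inv x = g \<otimes> h" using xG by blast
    qed
  next
    assume cosets: "noncentral_cosets_in_classes G H"
    show "noncentral_cosets_in_classes (G\<lparr>carrier := P\<rparr>) H"
      unfolding noncentral_cosets_in_classes_def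
    proof (intro ballI)
      fix g h assume g: "g \<in> carrier (G\<lparr>carrier := P\<rparr>) - center (G\<lparr>carrier := P\<rparr>)" and h: "h \<in> H"
      then have gP: "g \<in> P" and gZ: "g \<notin> center G" by (auto simp: center)
      have gG: "g \<in> carrier G" using gP PG by blast
      obtain x where x: "x \<in> carrier G" "x \<otimes> g \<otimes> inv x = g \<otimes> h"
        using cosets gG gZ h unfolding noncentral_cosets_in_classes_def by blast
      obtain u y where uy: "u \<in> P" "y \<in> Q" "x = u \<otimes> y"
        using x(1) unfolding PQ[symmetric] set_mult_def by blast
      then have c: "u \<in> carrier G" "y \<in> carrier G" using PG QG by auto
      have yZ: "y \<in> center G" using uy(2) QZ by blast
      have "x \<otimes> g \<otimes> inv x = u \<otimes> (y \<otimes> g) \<otimes> inv y \<otimes> inv u"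
        using c gG by (simp add: uy(3) inv_mult_group m_assoc)
      also have "\<dots> = u \<otimes> g \<otimes> inv u"
        unfolding center_commute[OF yZ gG] using c gG by (simp add: m_assoc)
      finally show "\<exists>x\<in>carrier (G\<lparr>carrier := P\<rparr>).
          x \<otimes>\<^bsub>G\<lparr>carrier := P\<rparr>\<^esub> g \<otimes>\<^bsub>G\<lparr>carrier := P\<rparr>\<^esub> inv\<^bsub>G\<lparr>carrier := P\<rparr>\<^esub> x =
            g \<otimes>\<^bsub>G\<lparr>carrier := P\<rparr>\<^esub> h"
        using uy(1) x(2) P by auto
    qed
  }
qed

end

theorem theorem2:
  fixes G :: "('a, 'b) monoid_scheme" (structure)
  assumes "group G" and "finite (carrier G)" and "\<not> comm_group G"
    and "U G \<noteq> {\<one>}"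
  shows "\<exists>p P Q. prime (p :: nat) \<and> internal_direct_product G P Q \<and>
           (\<exists>k. card P = p ^ k) \<and>
           comm_group (G\<lparr>carrier := Q\<rparr>) \<and> \<not> p dvd card Q \<and>
           U G = U (G\<lparr>carrier := P\<rparr>)"
proof -
  interpret finite_group G
    using assms(1,2) by (simp add: finite_group_def finite_group_axioms_def)
  have noncomm: "center G \<noteq> carrier G"
    using assms(3) comm_group_if_center_eq_carrier by blast
  define F where "F = {H. H \<lhd> G \<and> V_over G H \<subseteq> center G}"
  have F: "H \<in> F \<longleftrightarrow> H \<lhd> G \<and> noncentral_cosets_in_classes G H" for H
    using V_over_subset_center_iff_cosets by (auto simp: F_def)
  have UG: "U G = finprod (normal_subgroup_monoid G) (\<lambda>H. H) F"
    by (simp add: U_def U_over_def F_def)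
  interpret NG: comm_monoid "normal_subgroup_monoid G"
    by (rule comm_monoid_normal_subgroup_monoid)
  have "\<exists>H\<in>F. H \<noteq> {\<one>}"
    using assms(4) NG.finprod_one_eqI[of F "\<lambda>H. H"]
    unfolding UG by (auto simp: normal_subgroup_monoid_def)
  then obtain H0 where H0: "H0 \<in> F" "H0 \<noteq> {\<one>}" by blast
  have sub0: "subgroup H0 G" using H0(1) F normal_imp_subgroup by blast
  obtain h0 where h0: "h0 \<in> H0" "h0 \<noteq> \<one>"
    using H0(2) subgroup.one_closed[OF sub0] by blast
  have "h0 \<in> carrier G" using h0(1) sub0 subgroup.subset by blast
  then have "ord h0 \<noteq> 1" using h0(2) ord_eq_1 by blast
  then obtain p where p: "prime p" "p dvd ord h0" using prime_factor_nat by blast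
  have "order G \<noteq> 0" using finite_carrier order_gt_0_iff_finite by simp
  then obtain m where m: "order G = p ^ multiplicity p (order G) * m" "\<not> p dvd m"
    using multiplicity_decompose'[of "order G" p] p(1) by (metis not_prime_unit)
  define a where "a = multiplicity p (order G)"
  have ord: "order G = p ^ a * m" using m(1) by (simp add: a_def)
  have cop: "coprime (p ^ a) m" using p(1) m(2) by (simp add: prime_imp_coprime)
  have central: "x \<in> center G" if "x \<in> carrier G" "x [^] m = \<one>" for x
    using regular_elements_central[OF sub0 _ h0(1) p(2) m(2) that] H0(1) F by blast
  define Q where "Q = {x \<in> carrier G. x [^] m = \<one>}"
  obtain P where P: "subgroup P G" "card P = p ^ a" "internal_direct_product G P Q" "card Q = m"
    using direct_product_if_regular_elements_central[OF p(1) ord m(2) central]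
    unfolding Q_def by blast
  have QZ: "Q \<subseteq> center G" using central by (auto simp: Q_def)
  have QG: "Q \<subseteq> carrier G" by (auto simp: Q_def)
  have PQ: "P <#> Q = carrier G" and Q: "subgroup Q G"
    using P(3) normal_imp_subgroup by (auto simp: internal_direct_product_def)
  have PG: "P \<subseteq> carrier G" using P(1) by (rule subgroup.subset)
  interpret P: finite_group "G\<lparr>carrier := P\<rparr>"
    using subgroup_imp_group[OF P(1)] finite_subset[OF PG finite_carrier]
    by (simp add: finite_group_def finite_group_axioms_def)
  have comm_Q: "comm_group (G\<lparr>carrier := Q\<rparr>)"
    by (rule group.group_comm_groupI[OF subgroup_imp_group[OF Q]])
      (use QZ QG center_commute in auto)
  have in_P: "H \<subseteq> P" if H: "H \<in> F" for H
  proof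
    fix h assume h: "h \<in> H"
    have sub: "subgroup H G" using H F normal_imp_subgroup by blast
    then have hG: "h \<in> carrier G" using h subgroup.subset by blast
    (* Two different primes would make both coprime parts of every element central. *)
    have q_eq: "q = p" if q: "prime q" "q dvd ord h" for q
    proof (rule ccontr)
      assume "q \<noteq> p"
      then have "\<not> q dvd p ^ a" using p(1) q(1) by (metis prime_dvd_power primes_dvd_imp_eq)
      then have "x \<in> center G" if "x \<in> carrier G" "x [^] (p ^ a) = \<one>" for x
        using regular_elements_central[OF sub _ h q(2) _ that] H F by blast
      then show False
        using center_eq_carrier_if_coprime_parts_central[OF ord cop] central noncomm by blast
    qed
    have "coprime (ord h) m"
    proof (rule ccontr)
      assume "\<not> coprime (ord h) m"
      then obtain q where "prime q" "q dvd gcd (ord h) m"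
        using prime_factor_nat[of "gcd (ord h) m"] by (auto simp: coprime_iff_gcd_eq_1)
      then show False using q_eq m(2) by auto
    qed
    then have "ord h dvd p ^ a"
      using ord_dvd_group_order[OF hG] ord by (simp add: coprime_dvd_mult_left_iff)
    then have hp: "h [^] (p ^ a) = \<one>" using hG by (simp add: pow_eq_id)
    obtain u y where uy: "u \<in> P" "y \<in> Q" "h = u \<otimes> y"
      using hG unfolding PQ[symmetric] set_mult_def by blast
    then have c: "u \<in> carrier G" "y \<in> carrier G" using PG QG by auto
    have "u \<otimes> y = y \<otimes> u" using center_commute[of y u] uy(2) QZ c by auto
    then have "h [^] (p ^ a) = u [^] (p ^ a) \<otimes> y [^] (p ^ a)"
      unfolding uy(3) using c by (intro pow_mult_distrib)
    also have "u [^] (p ^ a) = \<one>" using pow_card_subgroup[OF P(1) uy(1)] by (simp add: P(2))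
    finally have "y [^] (p ^ a) = \<one>" using hp c by simp
    then have "y = \<one>"
      using eq_one_if_coprime_pows[OF c(2) _ _ cop] uy(2) by (simp add: Q_def)
    then show "h \<in> P" using uy c by simp
  qed
  have F_P: "F = {H. H \<lhd> G\<lparr>carrier := P\<rparr> \<and> V_over (G\<lparr>carrier := P\<rparr>) H \<subseteq> center (G\<lparr>carrier := P\<rparr>)}"
  proof (intro Set.set_eqI iffI)
    fix H assume H: "H \<in> F"
    have normal: "H \<lhd> G\<lparr>carrier := P\<rparr>"
      using normal_restrict_supergroup[OF P(1) _ in_P[OF H]] H F by blast
    then have "V_over (G\<lparr>carrier := P\<rparr>) H \<subseteq> center (G\<lparr>carrier := P\<rparr>)"
      using P.V_over_subset_center_iff_cosets H F
        noncentral_cosets_direct_factor_iff[OF P(1) QZ PQ in_P[OF H]] by blast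
    with normal show "H \<in> {H. H \<lhd> G\<lparr>carrier := P\<rparr> \<and>
        V_over (G\<lparr>carrier := P\<rparr>) H \<subseteq> center (G\<lparr>carrier := P\<rparr>)}" by simp
  next
    fix H assume "H \<in> {H. H \<lhd> G\<lparr>carrier := P\<rparr> \<and> V_over (G\<lparr>carrier := P\<rparr>) H \<subseteq> center (G\<lparr>carrier := P\<rparr>)}"
    then have H: "H \<lhd> G\<lparr>carrier := P\<rparr>" and "noncentral_cosets_in_classes (G\<lparr>carrier := P\<rparr>) H"
      using P.V_over_subset_center_iff_cosets by blast+
    have sP: "subgroup H (G\<lparr>carrier := P\<rparr>)" using H by (rule normal_imp_subgroup)
    then have "H \<subseteq> P" using subgroup.subset by fastforce
    then have cosets: "noncentral_cosets_in_classes G H"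
      using noncentral_cosets_direct_factor_iff[OF P(1) QZ PQ]
        \<open>noncentral_cosets_in_classes (G\<lparr>carrier := P\<rparr>) H\<close> by blast
    have "subgroup H G" using incl_subgroup[OF P(1) sP] .
    then have "H \<lhd> G"
      using subgroup_center_normal noncentral_cosets_imp_central cosets by blast
    then show "H \<in> F" using cosets F by blast
  qed
  have "finite F"
  proof (rule finite_subset)
    show "F \<subseteq> Pow (carrier G)" using PG in_P by blast
  qed (use finite_carrier in simp)
  then have "U G = finprod (normal_subgroup_monoid (G\<lparr>carrier := P\<rparr>)) (\<lambda>H. H) F"
    unfolding UG
    by (rule finprod_normal_subgroup_monoid_restrict[OF P(1)]) (simp add: F_def, simp add: F_P)
  also have "\<dots> = U (G\<lparr>carrier := P\<rparr>)"
    by (simp add: U_def U_over_def F_P)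
  finally show ?thesis
    using p(1) P m(2) comm_Q by blast
qed

end
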